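(* Let $N, K, T, M$ be positive integers with $K \le N$, $T\le N$ and $T+K\le N$. Then there exists an $(N,K,T;M)$-PIR scheme with rate $(1+R+R^2+\cdots+R^{M-1})^{-1}$, where $R=1-\frac{\binom{N-T}{K}}{\binom{N}{K}}$.
   Context: An $(N,K,T;M)$-PIR scheme is defined as follows. A distributed storage system has $N$ servers storing $M$ files $W^{[1]},\dots,W^{[M]}\in\mathbb{F}_q^{L\times K}$ (for some positive integer $L$ and some finite field $\mathbb{F}_q$, both of which the scheme may choose, $q$ large enough). The files are independent and uniformly distributed, so $H(W^{[m]})=LK$ (in $q$-ary units) and $H(W^{[1]},\dots,W^{[M]})=MLK$. Let $\mathbf{w}^{[m]}_j\in\mathbb{F}_q^K$ be the $j$-th row of $W^{[m]}$. Each file is stored with the same arbitrary given $(N,K)$-MDS code with generator matrix $\mathbf{G}=[\mathbf{g}_1\ \cdots\ \mathbf{g}_N]\in\mathbb{F}_q^{K\times N}$ (any $K$ columns linearly independent): server $n$ stores $\mathbf{y}_n=(\mathbf{w}^{[m]}_j\mathbf{g}_n)_{1\le m\le M,\,1\le j\le L}$. A user wishing to retrieve file $W^{[i]}$ uses private randomness $\mathcal{F}$ (unknown to servers); the servers may use common randomness $\mathcal{G}$ (known to the user); $\mathcal{F},\mathcal{G},i,W^{[1]},\dots,W^{[M]}$ are mutually independent. The user sends query $Q^{[i]}_n$ to server $n$, with $I(Q^{[i]}_1,\dots,Q^{[i]}_N;W^{[1]},\dots,W^{[M]})=0$; server $n$ returns an answer $A^{[i]}_n$ that is a deterministic function of $Q^{[i]}_n$,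 $\mathcal{G}$ and $\mathbf{y}_n$. Correctness: $H(W^{[i]}\mid Q^{[i]}_{1:N},A^{[i]}_{1:N},\mathcal{F},\mathcal{G})=0$. $T$-privacy: for every set $\mathcal{T}\subseteq\{1,\dots,N\}$ with $|\mathcal{T}|=T$, $I(i;Q^{[i]}_{\mathcal{T}})=I(i;A^{[i]}_{\mathcal{T}})=0$, where $Q^{[i]}_{\mathcal{T}}=\{Q^{[i]}_n:n\in\mathcal{T}\}$ and similarly for $A$. The rate of the scheme is $H(W^{[i]})/\sum_{n=1}^N H(A^{[i]}_n)$. The scheme is required to work for any underlying $(N,K)$-MDS storage code. *)

theory Defs
  imports "HOL-Probability.Probability" "HOL-Computational_Algebra.Primes"
begin

definition ent :: "real \<Rightarrow> 'a pmf \<Rightarrow> real" where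
  "ent b P = - (\<Sum>x\<in>set_pmf P. pmf P x * log b (pmf P x))"

definition H :: "real \<Rightarrow> 'w pmf \<Rightarrow> ('w \<Rightarrow> 'x) \<Rightarrow> real" where
  "H b P X = ent b (map_pmf X P)"

definition Hc :: "real \<Rightarrow> 'w pmf \<Rightarrow> ('w \<Rightarrow> 'x) \<Rightarrow> ('w \<Rightarrow> 'y) \<Rightarrow> real" where
  "Hc b P X Y = H b P (\<lambda>w. (X w, Y w)) - H b P Y"

definition MI :: "real \<Rightarrow> 'w pmf \<Rightarrow> ('w \<Rightarrow> 'x) \<Rightarrow> ('w \<Rightarrow> 'y) \<Rightarrow> real" where
  "MI b P X Y = H b P X + H b P Y - H b P (\<lambda>w. (X w, Y w))"

(* all file collections W: W m j k is entry (j,k) of file m (1<=m<=M, 1<=j<=L, 1<=k<=K) *)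
definition files :: "nat \<Rightarrow> nat \<Rightarrow> nat \<Rightarrow> nat \<Rightarrow> (nat \<Rightarrow> nat \<Rightarrow> nat \<Rightarrow> int) set" where
  "files p M L K = {W. \<forall>m j k.
      (m \<in> {1..M} \<and> j \<in> {1..L} \<and> k \<in> {1..K} \<longrightarrow> 0 \<le> W m j k \<and> W m j k < int p) \<and>
      (\<not> (m \<in> {1..M} \<and> j \<in> {1..L} \<and> k \<in> {1..K}) \<longrightarrow> W m j k = 0)}"

definition is_MDS_gen :: "nat \<Rightarrow> nat \<Rightarrow> nat \<Rightarrow> (nat \<Rightarrow> nat \<Rightarrow> int) \<Rightarrow> bool" where
  "is_MDS_gen p N K G \<longleftrightarrow>
     (\<forall>k n. (k \<in> {1..K} \<and> n \<in> {1..N} \<longrightarrow> 0 \<le> G k n \<and> G k n < int p) \<and>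
            (\<not> (k \<in> {1..K} \<and> n \<in> {1..N}) \<longrightarrow> G k n = 0)) \<and>
     (\<forall>S. S \<subseteq> {1..N} \<and> card S = K \<longrightarrow>
        (\<forall>a :: nat \<Rightarrow> int. (\<forall>k\<in>{1..K}. (\<Sum>n\<in>S. a n * G k n) mod int p = 0)
              \<longrightarrow> (\<forall>n\<in>S. a n mod int p = 0)))"

definition stored :: "nat \<Rightarrow> nat \<Rightarrow> nat \<Rightarrow> nat \<Rightarrow> (nat \<Rightarrow> nat \<Rightarrow> int)
      \<Rightarrow> (nat \<Rightarrow> nat \<Rightarrow> nat \<Rightarrow> int) \<Rightarrow> nat \<Rightarrow> (nat \<Rightarrow> nat \<Rightarrow> int)" where
  "stored p M L K G W n = (\<lambda>m j. if m \<in> {1..M} \<and> j \<in> {1..L}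
        then (\<Sum>k=1..K. W m j k * G k n) mod int p else 0)"

(* Outcome space (W, f, g): files uniform, user randomness f ~ PF, common randomness g ~ PG,
   mutually independent.  Queries qry i n f, answers ans n q g y. *)
definition outcome :: "nat \<Rightarrow> nat \<Rightarrow> nat \<Rightarrow> nat \<Rightarrow> nat pmf \<Rightarrow> nat pmf
      \<Rightarrow> ((nat \<Rightarrow> nat \<Rightarrow> nat \<Rightarrow> int) \<times> nat \<times> nat) pmf" where
  "outcome p M L K PF PG = pair_pmf (pmf_of_set (files p M L K)) (pair_pmf PF PG)"

definition Qset :: "(nat \<Rightarrow> nat \<Rightarrow> nat \<Rightarrow> nat) \<Rightarrow> nat \<Rightarrow> nat set \<Rightarrow> nat \<Rightarrow> (nat \<Rightarrow> nat)" where
  "Qset qry i S f = (\<lambda>n. if n \<in> S then qry i n f else 0)"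

definition Aone :: "nat \<Rightarrow> nat \<Rightarrow> nat \<Rightarrow> nat \<Rightarrow> (nat \<Rightarrow> nat \<Rightarrow> int)
      \<Rightarrow> (nat \<Rightarrow> nat \<Rightarrow> nat \<Rightarrow> nat)
      \<Rightarrow> (nat \<Rightarrow> nat \<Rightarrow> nat \<Rightarrow> (nat \<Rightarrow> nat \<Rightarrow> int) \<Rightarrow> nat)
      \<Rightarrow> nat \<Rightarrow> nat \<Rightarrow> ((nat \<Rightarrow> nat \<Rightarrow> nat \<Rightarrow> int) \<times> nat \<times> nat) \<Rightarrow> nat" where
  "Aone p M L K G qry ans i n \<omega> =
     (case \<omega> of (W, f, g) \<Rightarrow> ans n (qry i n f) g (stored p M L K G W n))"

definition Aset :: "nat \<Rightarrow> nat \<Rightarrow> nat \<Rightarrow> nat \<Rightarrow> (nat \<Rightarrow> nat \<Rightarrow> int)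
      \<Rightarrow> (nat \<Rightarrow> nat \<Rightarrow> nat \<Rightarrow> nat)
      \<Rightarrow> (nat \<Rightarrow> nat \<Rightarrow> nat \<Rightarrow> (nat \<Rightarrow> nat \<Rightarrow> int) \<Rightarrow> nat)
      \<Rightarrow> nat \<Rightarrow> nat set \<Rightarrow> ((nat \<Rightarrow> nat \<Rightarrow> nat \<Rightarrow> int) \<times> nat \<times> nat) \<Rightarrow> (nat \<Rightarrow> nat)" where
  "Aset p M L K G qry ans i S \<omega> = (\<lambda>n. if n \<in> S then Aone p M L K G qry ans i n \<omega> else 0)"

definition is_PIR_scheme :: "nat \<Rightarrow> nat \<Rightarrow> nat \<Rightarrow> nat \<Rightarrow> nat \<Rightarrow> nat \<Rightarrow> (nat \<Rightarrow> nat \<Rightarrow> int)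
      \<Rightarrow> nat pmf \<Rightarrow> nat pmf \<Rightarrow> (nat \<Rightarrow> nat \<Rightarrow> nat \<Rightarrow> nat)
      \<Rightarrow> (nat \<Rightarrow> nat \<Rightarrow> nat \<Rightarrow> (nat \<Rightarrow> nat \<Rightarrow> int) \<Rightarrow> nat) \<Rightarrow> bool" where
  "is_PIR_scheme p N K T M L G PF PG qry ans \<longleftrightarrow>
     finite (set_pmf PF) \<and> finite (set_pmf PG) \<and>
     (let P = outcome p M L K PF PG;
          PI = pair_pmf (pmf_of_set {1..M}) P in
      (\<forall>i\<in>{1..M}.
         \<comment> \<open>queries carry no information about the files\<close>
         MI (real p) P (\<lambda>(W, f, g). Qset qry i {1..N} f) (\<lambda>(W, f, g). W) = 0 \<and>
         \<comment> \<open>correctness\<close>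
         Hc (real p) P (\<lambda>(W, f, g). (\<lambda>j k. W i j k))
            (\<lambda>\<omega>. case \<omega> of (W, f, g) \<Rightarrow>
               (Qset qry i {1..N} f, Aset p M L K G qry ans i {1..N} \<omega>, f, g)) = 0) \<and>
      \<comment> \<open>T-privacy, with the desired index i uniform on {1..M} and independent of everything\<close>
      (\<forall>S. S \<subseteq> {1..N} \<and> card S = T \<longrightarrow>
         MI (real p) PI (\<lambda>(i, \<omega>). i) (\<lambda>(i, W, f, g). Qset qry i S f) = 0 \<and>
         MI (real p) PI (\<lambda>(i, \<omega>). i) (\<lambda>(i, \<omega>). Aset p M L K G qry ans i S \<omega>) = 0))"

definition PIR_rate :: "nat \<Rightarrow> nat \<Rightarrow> nat \<Rightarrow> nat \<Rightarrow> nat \<Rightarrow> (nat \<Rightarrow> nat \<Rightarrow> int)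
      \<Rightarrow> nat pmf \<Rightarrow> nat pmf \<Rightarrow> (nat \<Rightarrow> nat \<Rightarrow> nat \<Rightarrow> nat)
      \<Rightarrow> (nat \<Rightarrow> nat \<Rightarrow> nat \<Rightarrow> (nat \<Rightarrow> nat \<Rightarrow> int) \<Rightarrow> nat) \<Rightarrow> nat \<Rightarrow> real" where
  "PIR_rate p N K M L G PF PG qry ans i =
     (let P = outcome p M L K PF PG in
      H (real p) P (\<lambda>(W, f, g). (\<lambda>j k. W i j k)) /
      (\<Sum>n=1..N. H (real p) P (Aone p M L K G qry ans i n)))"

end

theory Submission
  imports Defs "HOL-Number_Theory.Cong"
begin

text \<open>Treat the \<open>a = N choose K\<close> blocks of \<open>K\<close> servers as virtual servers: a row combination of a
  file can be recovered from the \<open>K\<close> answers of a block, so a virtual server stores every file in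
  the clear. Any \<open>T\<close> colluding servers meet only \<open>b = a - ((N - T) choose K)\<close> blocks, so it suffices
  to protect replicated data on \<open>a\<close> servers against \<open>b\<close> colluding ones, which the Sun--Jafar scheme
  does at rate \<open>1 / (\<Sum>m<M. (b / a) ^ m)\<close>. There the user asks for sums of symbols over all nonempty
  sets \<open>\<Lambda>\<close> of files. Symbols of the wanted file are rows of a random invertible matrix; those of the other
  files are codewords of an \<open>(a * a, a * b)\<close> Vandermonde code, whose part carried by the sums
  avoiding the wanted file determines the interference in the sums containing it. The rows seen by
  \<open>b\<close> virtual servers form an information set of that code, so they are distributed like rows of a
  random invertible matrix too.\<close>

section \<open>Entropy of finite distributions\<close>

text \<open>One number makes decoding and privacy fit. A group has \<open>a * a\<close> slots,
  \<open>a\<close> per virtual server, of which \<open>b\<close> are pure interference. So there are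
  \<open>a * b\<close> pure interference slots, and \<open>b\<close> colluding servers see
  \<open>a * b\<close> slots too. A code of dimension \<open>a * b\<close> in which any
  \<open>a * b\<close> coordinates are independent serves both: the first set determines the
  interference, the second looks unconstrained. The points \<open>1..a * a\<close> yield such a code
  once \<open>a * a < p\<close>. The split \<open>b : a - b\<close> has to hold for every wanted
  file with the same request shape, which leads to the multiplicities \<open>reps\<close>. A
  binomial count then gives \<open>a ^ M\<close> sums containing a given file, whence
  \<open>L = a ^ M\<close> and square key matrices. Privacy needs no laws of submatrices: for each
  colluding set and each wanted file, a bijection of the finite key set turns the visible queries
  into index-free ones. In the rate \<open>K\<close> cancels: a slot costs \<open>K\<close> answers,
  one from each server of its block, and a file has \<open>L * K\<close> symbols.\<close>

lemma ent_map_inj: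
  assumes "inj_on f (set_pmf P)"
  shows "ent b (map_pmf f P) = ent b P"
  using assms by (simp add: ent_def sum.reindex pmf_map_inj)

lemma ent_pmf_of_set:
  assumes "finite A" "A \<noteq> {}"
  shows "ent b (pmf_of_set A) = log b (card A)"
proof -
  have "card A > 0" using assms by (simp add: card_gt_0_iff)
  then show ?thesis
    using assms by (simp add: ent_def log_divide)
qed

lemma ent_pair_pmf:
  assumes "finite (set_pmf A)" "finite (set_pmf B)"
  shows "ent b (pair_pmf A B) = ent b A + ent b B"
proof -
  have "(\<Sum>z\<in>set_pmf A \<times> set_pmf B. pmf (pair_pmf A B) z * log b (pmf (pair_pmf A B) z))
      = (\<Sum>x\<in>set_pmf A. \<Sum>y\<in>set_pmf B. pmf B y * (pmf A x * log b (pmf A x))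
            + pmf A x * (pmf B y * log b (pmf B y)))"
    unfolding sum.cartesian_product
  proof (intro sum.cong refl, clarify)
    fix x y assume "x \<in> set_pmf A" "y \<in> set_pmf B"
    then have "pmf A x > 0" "pmf B y > 0" by (auto simp: pmf_positive)
    then show "pmf (pair_pmf A B) (x, y) * log b (pmf (pair_pmf A B) (x, y)) =
        pmf B y * (pmf A x * log b (pmf A x)) + pmf A x * (pmf B y * log b (pmf B y))"
      by (simp add: pmf_pair log_mult algebra_simps)
  qed
  also have "\<dots> = (\<Sum>y\<in>set_pmf B. pmf B y) * (\<Sum>x\<in>set_pmf A. pmf A x * log b (pmf A x))
      + (\<Sum>x\<in>set_pmf A. pmf A x) * (\<Sum>y\<in>set_pmf B. pmf B y * log b (pmf B y))"
    by (simp add: sum.distrib sum_distrib_left[symmetric] sum_distrib_right[symmetric])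
  also have "(\<Sum>y\<in>set_pmf B. pmf B y) = 1"
    using assms by (simp add: sum_pmf_eq_1)
  also have "(\<Sum>x\<in>set_pmf A. pmf A x) = 1"
    using assms by (simp add: sum_pmf_eq_1)
  finally show ?thesis by (simp add: ent_def)
qed

lemma MI_eq_0:
  assumes "map_pmf (\<lambda>w. (X w, Y w)) P = pair_pmf (map_pmf X P) (map_pmf Y P)"
    and "finite (set_pmf P)"
  shows "MI b P X Y = 0"
  using assms by (simp add: MI_def H_def ent_pair_pmf)

lemma Hc_eq_0:
  assumes "\<And>w w'. w \<in> set_pmf P \<Longrightarrow> w' \<in> set_pmf P \<Longrightarrow> Y w = Y w' \<Longrightarrow> X w = X w'"
  shows "Hc b P X Y = 0"
proof -
  have "inj_on snd (set_pmf (map_pmf (\<lambda>w. (X w, Y w)) P))"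
  proof (rule inj_onI, unfold set_map_pmf)
    fix u v assume "u \<in> (\<lambda>w. (X w, Y w)) ` set_pmf P" "v \<in> (\<lambda>w. (X w, Y w)) ` set_pmf P"
      and eq: "snd u = snd v"
    then obtain w w' where w: "w \<in> set_pmf P" "u = (X w, Y w)" "w' \<in> set_pmf P" "v = (X w', Y w')"
      by blast
    moreover have "Y w = Y w'" using eq w by simp
    ultimately show "u = v" using assms[of w w'] by simp
  qed
  from ent_map_inj[OF this, of b] show ?thesis
    by (simp add: Hc_def H_def map_pmf_comp)
qed

text \<open>Both privacy conditions go through this: a conditional law that is the same for every
  index makes the joint law a product.\<close>

lemma MI_index_eq_0:
  assumes "\<And>i. i \<in> set_pmf I \<Longrightarrow> map_pmf (Z i) P = D"
    and "finite (set_pmf I)" "finite (set_pmf P)"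
  shows "MI b (pair_pmf I P) (\<lambda>(i, w). i) (\<lambda>(i, w). Z i w) = 0"
proof (rule MI_eq_0)
  have "map_pmf (\<lambda>u. (case u of (i, w) \<Rightarrow> i, case u of (i, w) \<Rightarrow> Z i w)) (pair_pmf I P)
      = bind_pmf I (\<lambda>i. map_pmf (Pair i) (map_pmf (Z i) P))"
    by (simp add: pair_pmf_def map_bind_pmf map_pmf_def bind_assoc_pmf bind_return_pmf)
  also have "\<dots> = bind_pmf I (\<lambda>i. map_pmf (Pair i) D)"
    using assms(1) by (intro bind_pmf_cong) auto
  also have "\<dots> = pair_pmf I D"
    by (simp add: pair_pmf_def map_pmf_def)
  finally have 1: "map_pmf (\<lambda>u. (case u of (i, w) \<Rightarrow> i, case u of (i, w) \<Rightarrow> Z i w)) (pair_pmf I P)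
      = pair_pmf I D" .
  then have "map_pmf snd (map_pmf (\<lambda>u. (case u of (i, w) \<Rightarrow> i, case u of (i, w) \<Rightarrow> Z i w)) (pair_pmf I P)) = D"
    by (simp add: map_snd_pair_pmf)
  then have 2: "map_pmf (\<lambda>(i, w). Z i w) (pair_pmf I P) = D"
    by (simp add: map_pmf_comp)
  have 3: "map_pmf (\<lambda>(i, w). i) (pair_pmf I P) = I"
    using map_fst_pair_pmf[of I P] by (simp add: case_prod_beta')
  show "map_pmf (\<lambda>w. (case w of (i, w) \<Rightarrow> i, case w of (i, w) \<Rightarrow> Z i w)) (pair_pmf I P) =
      pair_pmf (map_pmf (\<lambda>(i, w). i) (pair_pmf I P)) (map_pmf (\<lambda>(i, w). Z i w) (pair_pmf I P))"
    unfolding 1 2 3 ..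
  show "finite (set_pmf (pair_pmf I P))" using assms by simp
qed

section \<open>Images of uniform distributions, and the uniform law of the files\<close>

text \<open>An injection carrying the fibre over \<open>v\<close> into the fibre over
  \<open>v'\<close> bounds one size by the other; exchanging the two values gives equality.\<close>

lemma map_pmf_of_set_equal_fibres:
  assumes fin: "finite X" "X \<noteq> {}" "finite R" and im: "f ` X \<subseteq> R"
    and trans: "\<And>v v'. v \<in> R \<Longrightarrow> v' \<in> R \<Longrightarrow>
      \<exists>\<tau>. inj_on \<tau> X \<and> \<tau> ` X \<subseteq> X \<and> (\<forall>x\<in>X. f x = v \<longrightarrow> f (\<tau> x) = v')"
  shows "map_pmf f (pmf_of_set X) = pmf_of_set R"
proof -
  have le: "card {x\<in>X. f x = v} \<le> card {x\<in>X. f x = v'}" if v: "v \<in> R" "v' \<in> R" for v v'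
  proof -
    obtain \<tau> where \<tau>: "inj_on \<tau> X" "\<tau> ` X \<subseteq> X" "\<forall>x\<in>X. f x = v \<longrightarrow> f (\<tau> x) = v'"
      using trans[OF v] by blast
    show ?thesis
    proof (rule card_inj_on_le)
      show "inj_on \<tau> {x\<in>X. f x = v}" using \<tau>(1) by (auto simp: inj_on_def)
      show "\<tau> ` {x\<in>X. f x = v} \<subseteq> {x\<in>X. f x = v'}" using \<tau> by auto
    qed (use fin in auto)
  qed
  have R: "R \<noteq> {}" using im fin by auto
  then obtain v0 where v0: "v0 \<in> R" by blast
  define c where "c = card {x\<in>X. f x = v0}"
  have c: "card {x\<in>X. f x = v} = c" if "v \<in> R" for v
    using le[OF that v0] le[OF v0 that] by (simp add: c_def)
  have "card X = (\<Sum>v\<in>R. card {x\<in>X. f x = v})"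
    using sum.group[OF fin(1,3) im, of "\<lambda>_. 1 :: nat"] by simp
  also have "\<dots> = card R * c" using c by simp
  finally have cX: "card X = card R * c" .
  show ?thesis
  proof (rule pmf_eqI)
    fix v
    have "pmf (map_pmf f (pmf_of_set X)) v = card (X \<inter> f -` {v}) / card X"
      using fin by (simp add: pmf_map measure_pmf_of_set)
    also have "X \<inter> f -` {v} = {x\<in>X. f x = v}" by auto
    also have "card {x\<in>X. f x = v} / card X = pmf (pmf_of_set R) v"
    proof (cases "v \<in> R")
      case True
      have "c \<noteq> 0" using cX fin by auto
      then show ?thesis using True R fin c[OF True] cX by simp
    next
      case False
      then have e: "{x\<in>X. f x = v} = {}" using im by auto
      show ?thesis unfolding e using False R fin by simp
    qed
    finally show "pmf (map_pmf f (pmf_of_set X)) v = pmf (pmf_of_set R) v" .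
  qed
qed

definition residue_vectors :: "nat \<Rightarrow> 'a set \<Rightarrow> ('a \<Rightarrow> int) set" where
  "residue_vectors p I = PiE_dflt I 0 (\<lambda>_. {0..<int p})"

lemma residue_vectors_iff:
  "v \<in> residue_vectors p I \<longleftrightarrow> (\<forall>x. (x \<in> I \<longrightarrow> 0 \<le> v x \<and> v x < int p) \<and> (x \<notin> I \<longrightarrow> v x = 0))"
  by (auto simp: residue_vectors_def PiE_dflt_def)

lemma finite_residue_vectors: "finite I \<Longrightarrow> finite (residue_vectors p I)"
  unfolding residue_vectors_def by (rule finite_PiE_dflt) auto

lemma card_residue_vectors: "finite I \<Longrightarrow> card (residue_vectors p I) = p ^ card I"
  unfolding residue_vectors_def by (subst card_PiE_dflt) auto

lemma residue_vectors_eqI: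
  assumes "v \<in> residue_vectors p I" "v' \<in> residue_vectors p I"
    and "\<And>x. x \<in> I \<Longrightarrow> int p dvd v x - v' x"
  shows "v = v'"
proof
  fix x
  show "v x = v' x"
  proof (cases "x \<in> I")
    case True
    have "0 \<le> v x" "v x < int p" "0 \<le> v' x" "v' x < int p"
      using True assms(1,2) by (auto simp: residue_vectors_iff)
    moreover have "v x mod int p = v' x mod int p"
      using assms(3)[OF True] by (simp add: mod_eq_dvd_iff)
    ultimately show ?thesis by simp
  qed (use assms in \<open>auto simp: residue_vectors_iff\<close>)
qed

lemma finite_files: "finite (files p M L K)"
proof -
  let ?I = "{1..M} \<times> {1..L} \<times> {1..K}"
  have "files p M L K \<subseteq> (\<lambda>v m j k. v (m, j, k)) ` residue_vectors p ?I"
  proof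
    fix W assume W: "W \<in> files p M L K"
    show "W \<in> (\<lambda>v m j k. v (m, j, k)) ` residue_vectors p ?I"
      by (rule image_eqI[of _ _ "\<lambda>(m, j, k). W m j k"])
        (use W in \<open>auto simp: residue_vectors_iff files_def\<close>)
  qed
  then show ?thesis by (rule finite_subset) (simp add: finite_residue_vectors)
qed

lemma files_nonempty: "0 < p \<Longrightarrow> files p M L K \<noteq> {}"
proof -
  assume "0 < p"
  then have "(\<lambda>_ _ _. 0) \<in> files p M L K" by (simp add: files_def)
  then show ?thesis by blast
qed

definition file_residue :: "nat \<Rightarrow> nat \<Rightarrow> nat \<Rightarrow> nat \<Rightarrow> (nat \<Rightarrow> nat \<Rightarrow> nat \<Rightarrow> int) \<Rightarrow> nat \<Rightarrow> nat \<Rightarrow> nat \<Rightarrow> int" where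
  "file_residue p M L K W = (\<lambda>m j k. if m \<in> {1..M} \<and> j \<in> {1..L} \<and> k \<in> {1..K} then W m j k mod int p else 0)"

lemma file_residue_in_files: "0 < p \<Longrightarrow> file_residue p M L K W \<in> files p M L K"
  by (auto simp: files_def file_residue_def)

lemma inj_on_file_translation:
  "inj_on (\<lambda>W. file_residue p M L K (\<lambda>m j k. W m j k + W0 m j k)) (files p M L K)"
proof (rule inj_onI)
  fix W W' assume W: "W \<in> files p M L K" and W': "W' \<in> files p M L K"
    and eq: "file_residue p M L K (\<lambda>m j k. W m j k + W0 m j k)
      = file_residue p M L K (\<lambda>m j k. W' m j k + W0 m j k)"
  show "W = W'"
  proof (intro ext)
    fix m j k
    show "W m j k = W' m j k"
    proof (cases "m \<in> {1..M} \<and> j \<in> {1..L} \<and> k \<in> {1..K}")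
      case True
      then have "(W m j k + W0 m j k) mod int p = (W' m j k + W0 m j k) mod int p"
        using fun_cong[OF fun_cong[OF fun_cong[OF eq]], of m j k] by (simp add: file_residue_def)
      then have "W m j k mod int p = W' m j k mod int p"
        by (simp add: mod_eq_dvd_iff)
      moreover have "0 \<le> W m j k \<and> W m j k < int p" "0 \<le> W' m j k \<and> W' m j k < int p"
        using W W' True by (auto simp: files_def)
      ultimately show ?thesis by simp
    qed (use W W' in \<open>auto simp: files_def\<close>)
  qed
qed

text \<open>Translations by a fixed array are injections of the files, so they can serve to compare
  fibres. Used for the law of a single file and for that of an answer.\<close>

lemma map_pmf_files_translation:
  assumes "0 < p" "finite R" "f ` files p M L K \<subseteq> R"
    and "\<And>v v'. v \<in> R \<Longrightarrow> v' \<in> R \<Longrightarrow> \<exists>W0. \<forall>W\<in>files p M L K.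
       f W = v \<longrightarrow> f (file_residue p M L K (\<lambda>m j k. W m j k + W0 m j k)) = v'"
  shows "map_pmf f (pmf_of_set (files p M L K)) = pmf_of_set R"
proof (rule map_pmf_of_set_equal_fibres)
  fix v v' assume v: "v \<in> R" "v' \<in> R"
  obtain W0 where W0: "\<forall>W\<in>files p M L K.
       f W = v \<longrightarrow> f (file_residue p M L K (\<lambda>m j k. W m j k + W0 m j k)) = v'"
    using assms(4)[OF v] by blast
  have "(\<lambda>W. file_residue p M L K (\<lambda>m j k. W m j k + W0 m j k)) ` files p M L K \<subseteq> files p M L K"
    using file_residue_in_files[OF assms(1)] by blast
  then show "\<exists>\<tau>. inj_on \<tau> (files p M L K) \<and> \<tau> ` files p M L K \<subseteq> files p M L K
      \<and> (\<forall>x\<in>files p M L K. f x = v \<longrightarrow> f (\<tau> x) = v')"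
    using inj_on_file_translation W0 by blast
qed (use assms finite_files files_nonempty in auto)

lemma ent_single_file:
  assumes "1 < p" "i \<in> {1..M}"
  shows "ent (real p) (map_pmf (\<lambda>W j k. W i j k) (pmf_of_set (files p M L K))) = real (L * K)"
proof -
  let ?V = "residue_vectors p ({1..L} \<times> {1..K})"
  let ?h = "\<lambda>(v :: nat \<times> nat \<Rightarrow> int) j k. v (j, k)"
  define R where "R = ?h ` ?V"
  have inj: "inj_on ?h ?V"
  proof (rule inj_onI, rule ext)
    fix u v :: "nat \<times> nat \<Rightarrow> int" and x
    assume "?h u = ?h v"
    then show "u x = v x" by (cases x) (metis)
  qed
  have finV: "finite ?V" by (simp add: finite_residue_vectors)
  have R: "w \<in> R \<longleftrightarrow> (\<forall>j k. (j \<in> {1..L} \<and> k \<in> {1..K} \<longrightarrow> 0 \<le> w j k \<and> w j k < int p)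
      \<and> (\<not> (j \<in> {1..L} \<and> k \<in> {1..K}) \<longrightarrow> w j k = 0))" (is "_ \<longleftrightarrow> ?P w") for w
  proof
    assume "?P w"
    then have "(\<lambda>(j, k). w j k) \<in> ?V" by (auto simp: residue_vectors_iff)
    then show "w \<in> R" unfolding R_def by (rule rev_image_eqI) simp
  qed (auto simp: R_def residue_vectors_iff)
  have cR: "card R = p ^ (L * K)"
    unfolding R_def card_image[OF inj] by (simp add: card_residue_vectors)
  have "map_pmf (\<lambda>W j k. W i j k) (pmf_of_set (files p M L K)) = pmf_of_set R"
  proof (rule map_pmf_files_translation)
    show "finite R" using finV by (simp add: R_def)
    show "(\<lambda>W j k. W i j k) ` files p M L K \<subseteq> R"
      using assms(2) by (auto simp: R files_def)
    fix v v' assume v: "v \<in> R" "v' \<in> R"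
    show "\<exists>W0. \<forall>W\<in>files p M L K. (\<lambda>j k. W i j k) = v \<longrightarrow>
        (\<lambda>j k. file_residue p M L K (\<lambda>m j k. W m j k + W0 m j k) i j k) = v'"
    proof (rule exI[of _ "\<lambda>m j k. v' j k - v j k"], intro ballI impI ext)
      fix W :: "nat \<Rightarrow> nat \<Rightarrow> nat \<Rightarrow> int" and j k
      assume "(\<lambda>j k. W i j k) = v"
      then have "W i j k = v j k" by metis
      then show "file_residue p M L K (\<lambda>m j k. W m j k + (v' j k - v j k)) i j k = v' j k"
        using v(2) assms(2) unfolding R file_residue_def by auto
    qed
  qed (use assms in auto)
  moreover have "R \<noteq> {}" "finite R" using cR assms finV by (auto simp: R_def)
  moreover have "log (real p) (real (card R)) = real (L * K)"
    using assms unfolding cR by (simp add: log_nat_power)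
  ultimately show ?thesis by (simp add: ent_pmf_of_set)
qed

section \<open>From finite combinatorial data to entropies\<close>

text \<open>Confines the probability to one place. The construction then owes a bijection of keys
  per colluding set and wanted file (privacy), injectivity in the wanted file (correctness) and
  uniform index-free answers (rate). Queries and answers of arbitrary types are numbered through the
  finite sets of those that occur.\<close>

lemma PIR_scheme_of_finite_scheme:
  fixes query :: "nat \<Rightarrow> nat \<Rightarrow> 'f \<Rightarrow> 'q" and raw :: "nat \<Rightarrow> 'f \<Rightarrow> 'q"
    and answer :: "nat \<Rightarrow> 'q \<Rightarrow> (nat \<Rightarrow> nat \<Rightarrow> int) \<Rightarrow> 'a"
  assumes T: "0 < T" "T \<le> N" and M: "0 < M" and p: "1 < p" and F: "finite F" "F \<noteq> {}"
    and priv: "\<And>S i. S \<subseteq> {1..N} \<Longrightarrow> card S = T \<Longrightarrow> i \<in> {1..M} \<Longrightarrow>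
      \<exists>\<phi>. bij_betw \<phi> F F \<and> (\<forall>f\<in>F. \<forall>n\<in>S. query i n f = raw n (\<phi> f))"
    and dec: "\<And>i f W W'. i \<in> {1..M} \<Longrightarrow> f \<in> F \<Longrightarrow> W \<in> files p M L K \<Longrightarrow> W' \<in> files p M L K \<Longrightarrow>
      (\<And>n. n \<in> {1..N} \<Longrightarrow> answer n (query i n f) (stored p M L K G W n)
          = answer n (query i n f) (stored p M L K G W' n)) \<Longrightarrow> W i = W' i"
    and R: "\<And>n. n \<in> {1..N} \<Longrightarrow> finite (R n)" "\<And>n. n \<in> {1..N} \<Longrightarrow> R n \<noteq> {}"
    and unif: "\<And>n f. n \<in> {1..N} \<Longrightarrow> f \<in> F \<Longrightarrow>
      map_pmf (\<lambda>W. answer n (raw n f) (stored p M L K G W n)) (pmf_of_set (files p M L K)) = pmf_of_set (R n)"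
  shows "\<exists>PF PG qry ans. is_PIR_scheme p N K T M L G PF PG qry ans \<and>
    (\<forall>i\<in>{1..M}. PIR_rate p N K M L G PF PG qry ans i
      = real (L * K) / (\<Sum>n=1..N. log (real p) (real (card (R n)))))"
proof -
  let ?W = "pmf_of_set (files p M L K)"
  define dF where "dF = from_nat_into F"
  define Qs where "Qs = (\<lambda>(i, n, f). query i n f) ` ({1..M} \<times> {1..N} \<times> F)"
  define eQ where "eQ = to_nat_on Qs"
  define dQ where "dQ = from_nat_into Qs"
  define As where "As = (\<lambda>(n, q, W). answer n q (stored p M L K G W n)) ` ({1..N} \<times> Qs \<times> files p M L K)"
  define eA where "eA = to_nat_on As"
  define PF where "PF = map_pmf (to_nat_on F) (pmf_of_set F)"
  define PG :: "nat pmf" where "PG = return_pmf 0"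
  define qry where "qry = (\<lambda>i n f. eQ (query i n (dF f)))"
  define ans where "ans = (\<lambda>n q (g :: nat) y. eA (answer n (dQ q) y))"
  define P where "P = outcome p M L K PF PG"
  note fin = finite_files[of p M L K]
  have ne: "files p M L K \<noteq> {}" using files_nonempty p by simp
  have finQs: "finite Qs" unfolding Qs_def using F by auto
  have finAs: "finite As" unfolding As_def using fin finQs by auto
  have dF_enc: "dF (to_nat_on F f) = f" if "f \<in> F" for f
    using that F by (simp add: dF_def countable_finite)
  have dQ_eQ: "dQ (eQ q) = q" if "q \<in> Qs" for q
    using that finQs by (simp add: dQ_def eQ_def countable_finite)
  have inj_eA: "inj_on eA As"
    unfolding eA_def using finAs by (simp add: countable_finite inj_on_to_nat_on)
  have set_PF: "set_pmf PF = to_nat_on F ` F" using F by (simp add: PF_def)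
  have query_Qs: "query i n f \<in> Qs" if "i \<in> {1..M}" "n \<in> {1..N}" "f \<in> F" for i n f
    unfolding Qs_def using that by (intro image_eqI[of _ _ "(i, n, f)"]) auto
  have answer_As: "answer n q (stored p M L K G W n) \<in> As"
    if "n \<in> {1..N}" "q \<in> Qs" "W \<in> files p M L K" for n q W
    unfolding As_def using that by (intro image_eqI[of _ _ "(n, q, W)"]) auto
  have set_P: "set_pmf P = files p M L K \<times> set_pmf PF \<times> {0}"
    using fin ne by (simp add: P_def outcome_def PG_def)
  have finPF: "finite (set_pmf PF)" using F by (simp add: set_PF)
  have finP: "finite (set_pmf P)" using fin finPF by (simp add: set_P)
  have setI: "set_pmf (pmf_of_set {1..M}) = {1..M}" using M by (intro set_pmf_of_set) auto

  \<comment> \<open>The law of the index-free queries at \<open>S\<close>. As \<open>\<phi>\<close>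
    permutes \<open>F\<close>, it is also the law of the actual queries, for every
    \<open>i\<close>.\<close>
  define D where "D = (\<lambda>S. map_pmf (\<lambda>f n. if n \<in> S then eQ (raw n f) else 0) (pmf_of_set F))"
  have law_Q: "map_pmf (Qset qry i S) PF = D S" if "S \<subseteq> {1..N}" "card S = T" "i \<in> {1..M}" for i S
  proof -
    obtain \<phi> where \<phi>: "bij_betw \<phi> F F" "\<forall>f\<in>F. \<forall>n\<in>S. query i n f = raw n (\<phi> f)"
      using priv[OF \<open>S \<subseteq> {1..N}\<close> \<open>card S = T\<close> \<open>i \<in> {1..M}\<close>] by blast
    have "map_pmf (Qset qry i S) PF
        = map_pmf (\<lambda>f n. if n \<in> S then eQ (raw n (\<phi> f)) else 0) (pmf_of_set F)"
      unfolding PF_def map_pmf_comp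
    proof (intro map_pmf_cong refl ext)
      fix f n assume "f \<in> set_pmf (pmf_of_set F)"
      then have "f \<in> F" using F by simp
      then show "Qset qry i S (to_nat_on F f) n = (if n \<in> S then eQ (raw n (\<phi> f)) else 0)"
        using \<phi>(2) by (simp add: Qset_def qry_def dF_enc)
    qed
    also have "\<dots> = map_pmf (\<lambda>f n. if n \<in> S then eQ (raw n f) else 0) (map_pmf \<phi> (pmf_of_set F))"
      by (simp add: map_pmf_comp)
    also have "map_pmf \<phi> (pmf_of_set F) = pmf_of_set F"
      using \<phi>(1) F by (simp add: map_pmf_of_set_bij_betw)
    finally show ?thesis by (simp add: D_def)
  qed
  have law_WQ: "map_pmf (\<lambda>(W, f, g). (W, Qset qry i S f)) P = pair_pmf ?W (map_pmf (Qset qry i S) PF)" for i S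
    by (simp add: P_def outcome_def PG_def pair_return_pmf2 pair_map_pmf2 map_pmf_comp case_prod_beta' apsnd_def map_prod_def)

  have queries_indep: "MI (real p) P (\<lambda>(W, f, g). Qset qry i {1..N} f) (\<lambda>(W, f, g). W) = 0" for i
  proof (rule MI_eq_0[OF _ finP])
    have 1: "map_pmf (\<lambda>(W, f, g). Qset qry i {1..N} f) P = map_pmf (Qset qry i {1..N}) PF"
      using arg_cong[OF law_WQ[of i "{1..N}"], of "map_pmf snd"]
      by (simp add: map_pmf_comp map_snd_pair_pmf case_prod_beta')
    have 2: "map_pmf (\<lambda>(W, f, g). W) P = ?W"
      using arg_cong[OF law_WQ[of i "{1..N}"], of "map_pmf fst"]
      by (simp add: map_pmf_comp map_fst_pair_pmf case_prod_beta')
    have 3: "map_pmf (\<lambda>w. (case w of (W, f, g) \<Rightarrow> Qset qry i {1..N} f, case w of (W, f, g) \<Rightarrow> W)) P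
        = map_pmf (\<lambda>(x, y). (y, x)) (map_pmf (\<lambda>(W, f, g). (W, Qset qry i {1..N} f)) P)"
      by (simp add: map_pmf_comp case_prod_beta')
    show "map_pmf (\<lambda>w. (case w of (W, f, g) \<Rightarrow> Qset qry i {1..N} f, case w of (W, f, g) \<Rightarrow> W)) P =
        pair_pmf (map_pmf (\<lambda>(W, f, g). Qset qry i {1..N} f) P) (map_pmf (\<lambda>(W, f, g). W) P)"
      unfolding 1 2 3 law_WQ by (rule pair_commute_pmf[symmetric])
  qed

  have correct: "Hc (real p) P (\<lambda>(W, f, g). (\<lambda>j k. W i j k))
            (\<lambda>\<omega>. case \<omega> of (W, f, g) \<Rightarrow>
               (Qset qry i {1..N} f, Aset p M L K G qry ans i {1..N} \<omega>, f, g)) = 0"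
    if i: "i \<in> {1..M}" for i
  proof (rule Hc_eq_0)
    fix w w' assume w: "w \<in> set_pmf P" "w' \<in> set_pmf P"
      and eq: "(case w of (W, f, g) \<Rightarrow> (Qset qry i {1..N} f, Aset p M L K G qry ans i {1..N} w, f, g))
        = (case w' of (W, f, g) \<Rightarrow> (Qset qry i {1..N} f, Aset p M L K G qry ans i {1..N} w', f, g))"
    obtain W k W' where W: "w = (W, to_nat_on F k, 0)" "w' = (W', to_nat_on F k, 0)"
        "W \<in> files p M L K" "W' \<in> files p M L K" "k \<in> F"
      using w eq by (auto simp: set_P set_PF)
    have "W i = W' i"
    proof (rule dec[OF i W(5,3,4)])
      fix n assume n: "n \<in> {1..N}"
      have q: "query i n k \<in> Qs" by (rule query_Qs[OF i n W(5)])
      have "Aset p M L K G qry ans i {1..N} w n = Aset p M L K G qry ans i {1..N} w' n"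
        using eq unfolding W by simp
      then have "eA (answer n (query i n k) (stored p M L K G W n))
          = eA (answer n (query i n k) (stored p M L K G W' n))"
        using n q W(5) by (simp add: W(1,2) Aset_def Aone_def ans_def qry_def dF_enc dQ_eQ)
      then show "answer n (query i n k) (stored p M L K G W n)
          = answer n (query i n k) (stored p M L K G W' n)"
        using inj_onD[OF inj_eA] answer_As[OF n q] W(3,4) by blast
    qed
    then show "(case w of (W, f, g) \<Rightarrow> (\<lambda>j k. W i j k)) = (case w' of (W, f, g) \<Rightarrow> (\<lambda>j k. W i j k))"
      by (simp add: W)
  qed

  have priv_Q: "MI (real p) (pair_pmf (pmf_of_set {1..M}) P) (\<lambda>(i, \<omega>). i) (\<lambda>(i, W, f, g). Qset qry i S f) = 0"
    if S: "S \<subseteq> {1..N}" "card S = T" for S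
  proof (rule MI_index_eq_0)
    fix i assume "i \<in> set_pmf (pmf_of_set {1..M})"
    then have i: "i \<in> {1..M}" by (simp only: setI)
    show "map_pmf (\<lambda>(W, f, g). Qset qry i S f) P = D S"
      using arg_cong[OF law_WQ[of i S], of "map_pmf snd"] law_Q[OF S i]
      by (simp add: map_pmf_comp map_snd_pair_pmf case_prod_beta')
  qed (use finP M in \<open>auto simp: setI\<close>)

  have priv_A: "MI (real p) (pair_pmf (pmf_of_set {1..M}) P) (\<lambda>(i, \<omega>). i)
      (\<lambda>(i, \<omega>). Aset p M L K G qry ans i S \<omega>) = 0"
    if S: "S \<subseteq> {1..N}" "card S = T" for S
  proof (rule MI_index_eq_0)
    fix i assume "i \<in> set_pmf (pmf_of_set {1..M})"
    then have i: "i \<in> {1..M}" by (simp only: setI)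
    \<comment> \<open>The answers at \<open>S\<close> are a function of the files and the queries at
      \<open>S\<close>, whose joint law does not involve \<open>i\<close>.\<close>
    let ?r = "\<lambda>(W, q) n. if n \<in> S then eA (answer n (dQ (q n)) (stored p M L K G W n)) else 0"
    have "Aset p M L K G qry ans i S = (\<lambda>w. ?r (case w of (W, f, g) \<Rightarrow> (W, Qset qry i S f)))"
      by (auto simp: Aset_def Aone_def ans_def Qset_def fun_eq_iff)
    then have "map_pmf (Aset p M L K G qry ans i S) P
        = map_pmf ?r (map_pmf (\<lambda>(W, f, g). (W, Qset qry i S f)) P)"
      by (simp add: map_pmf_comp)
    then show "map_pmf (Aset p M L K G qry ans i S) P = map_pmf ?r (pair_pmf ?W (D S))"
      by (simp only: law_WQ law_Q[OF S i])
  qed (use finP M in \<open>auto simp: setI\<close>)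

  have H_file: "H (real p) P (\<lambda>(W, f, g). (\<lambda>j k. W i j k)) = real (L * K)" if i: "i \<in> {1..M}" for i
  proof -
    have "map_pmf (\<lambda>(W, f, g). (\<lambda>j k. W i j k)) P = map_pmf (\<lambda>W j k. W i j k) (map_pmf fst P)"
      by (simp add: map_pmf_comp case_prod_beta')
    also have "map_pmf fst P = ?W" by (simp add: P_def outcome_def map_fst_pair_pmf)
    finally show ?thesis unfolding H_def by (simp only: ent_single_file[OF p i])
  qed

  have H_answer: "H (real p) P (Aone p M L K G qry ans i n) = log (real p) (real (card (R n)))"
    if i: "i \<in> {1..M}" and n: "n \<in> {1..N}" for i n
  proof -
    \<comment> \<open>Uniformity is known for \<open>raw\<close> only. As \<open>0 < T\<close>,
      server \<open>n\<close> lies in some set of size \<open>T\<close>, on which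
      \<open>query\<close> can be exchanged for \<open>raw\<close>.\<close>
    obtain S where S: "n \<in> S" "S \<subseteq> {1..N}" "card S = T"
    proof -
      have "T - 1 \<le> card ({1..N} - {n})" using T n by simp
      from obtain_subset_with_card_n[OF this]
      obtain S' where S': "S' \<subseteq> {1..N} - {n}" "card S' = T - 1" by metis
      then have "finite S'" using finite_subset by fast
      moreover have "n \<notin> S'" using S' by blast
      ultimately have "card (insert n S') = T" using S' T by simp
      then show thesis using that[of "insert n S'"] S' n by blast
    qed
    obtain \<phi> where \<phi>: "bij_betw \<phi> F F" "\<forall>f\<in>F. \<forall>n\<in>S. query i n f = raw n (\<phi> f)"
      using priv[OF S(2,3) i] by blast
    have \<phi>F: "\<phi> f \<in> F" if "f \<in> F" for f using \<phi>(1) that by (auto simp: bij_betw_def)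
    \<comment> \<open>For each fixed key the numbered answer has one and the same law, so averaging
      over the keys changes nothing.\<close>
    have "map_pmf (Aone p M L K G qry ans i n) P
        = bind_pmf PF (\<lambda>f. map_pmf (\<lambda>W. ans n (qry i n f) 0 (stored p M L K G W n)) ?W)"
      by (simp add: P_def outcome_def PG_def pair_return_pmf2 pair_pmf_def map_pmf_def bind_assoc_pmf
          bind_return_pmf Aone_def bind_commute_pmf[of ?W])
    also have "\<dots> = bind_pmf PF (\<lambda>f. map_pmf eA (pmf_of_set (R n)))"
    proof (intro bind_pmf_cong refl)
      fix f assume "f \<in> set_pmf PF"
      then obtain k where k: "k \<in> F" "f = to_nat_on F k" by (auto simp: set_PF)
      have "map_pmf (\<lambda>W. ans n (qry i n f) 0 (stored p M L K G W n)) ?W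
          = map_pmf eA (map_pmf (\<lambda>W. answer n (raw n (\<phi> k)) (stored p M L K G W n)) ?W)"
        using \<phi>(2) k S(1) query_Qs[OF i n k(1)]
        by (simp add: map_pmf_comp ans_def qry_def dF_enc dQ_eQ)
      then show "map_pmf (\<lambda>W. ans n (qry i n f) 0 (stored p M L K G W n)) ?W = map_pmf eA (pmf_of_set (R n))"
        by (simp only: unif[OF n \<phi>F[OF k(1)]])
    qed
    finally have law: "map_pmf (Aone p M L K G qry ans i n) P = map_pmf eA (pmf_of_set (R n))" by simp
    obtain k where k: "k \<in> F" using F by blast
    \<comment> \<open>\<open>eA\<close> is known to be injective on \<open>As\<close> only;
      \<open>R n\<close> lies inside, being the set of answers given under the key
      \<open>k\<close>.\<close>
    have "R n = set_pmf (map_pmf (\<lambda>W. answer n (raw n (\<phi> k)) (stored p M L K G W n)) ?W)"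
      using unif[OF n \<phi>F[OF k]] R[OF n] by simp
    also have "\<dots> = (\<lambda>W. answer n (query i n k) (stored p M L K G W n)) ` files p M L K"
      using \<phi>(2) k S(1) fin ne by simp
    also have "\<dots> \<subseteq> As" using answer_As[OF n query_Qs[OF i n k]] by blast
    finally have "inj_on eA (set_pmf (pmf_of_set (R n)))"
      using R[OF n] inj_on_subset[OF inj_eA] by simp
    then show ?thesis
      using R[OF n] by (simp add: H_def law ent_map_inj ent_pmf_of_set)
  qed

  have "is_PIR_scheme p N K T M L G PF PG qry ans"
    unfolding is_PIR_scheme_def Let_def P_def[symmetric]
    using finPF queries_indep correct priv_Q priv_A by (simp add: PG_def)
  moreover have "PIR_rate p N K M L G PF PG qry ans i
      = real (L * K) / (\<Sum>n=1..N. log (real p) (real (card (R n))))" if "i \<in> {1..M}" for i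
  proof -
    have "(\<Sum>n=1..N. H (real p) P (Aone p M L K G qry ans i n)) = (\<Sum>n=1..N. log (real p) (real (card (R n))))"
      by (intro sum.cong refl H_answer[OF that])
    then show ?thesis
      unfolding PIR_rate_def Let_def P_def[symmetric] by (simp only: H_file[OF that])
  qed
  ultimately show ?thesis by blast
qed

section \<open>Linear algebra modulo a prime\<close>

text \<open>Lagrange's bound on roots modulo \<open>p\<close>: split off one root \<open>y\<close>,
  apply induction to the quotient on the other points, then recover the coefficients.\<close>

lemma prime_dvd_poly_coeffs:
  fixes a :: "nat \<Rightarrow> int"
  assumes "prime p" "finite X" "card X = d"
    and "\<And>x y. x \<in> X \<Longrightarrow> y \<in> X \<Longrightarrow> x \<noteq> y \<Longrightarrow> \<not> int p dvd x - y"
    and "\<And>x. x \<in> X \<Longrightarrow> int p dvd (\<Sum>e<d. x ^ e * a e)"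
    and "e < d"
  shows "int p dvd a e"
  using assms(2-)
proof (induction d arbitrary: a X e)
  case (Suc d)
  then obtain y where y: "y \<in> X" by fastforce
  \<comment> \<open>Coefficients of the quotient by \<open>x - y\<close>, once the value at
    \<open>y\<close> has been subtracted.\<close>
  define b where "b = (\<lambda>e. \<Sum>i\<in>{Suc e..d}. a i * y ^ (i - e - 1))"
  have factor: "(\<Sum>e<Suc d. x ^ e * a e) - (\<Sum>e<Suc d. y ^ e * a e) = (x - y) * (\<Sum>e<d. x ^ e * b e)" for x
  proof (cases d)
    case (Suc d')
    then show ?thesis
      using polyfun_diff[of d a x y] by (simp add: b_def lessThan_Suc_atMost mult.commute)
  qed simp
  have b: "int p dvd b e" if "e < d" for e
  proof (rule Suc.IH[of "X - {y}"])
    fix x assume x: "x \<in> X - {y}"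
    have "int p dvd (x - y) * (\<Sum>e<d. x ^ e * b e)"
      unfolding factor[symmetric] using Suc.prems(4) x y by (intro dvd_diff) auto
    moreover have "\<not> int p dvd x - y" using Suc.prems(3) x y by blast
    ultimately show "int p dvd (\<Sum>e<d. x ^ e * b e)"
      using assms(1) by (simp add: prime_dvd_mult_iff)
  qed (use Suc.prems y that in auto)
  \<comment> \<open>Downward in \<open>e\<close>: \<open>b e\<close> is \<open>a (Suc e)\<close>
    plus a combination of later coefficients.\<close>
  have a_b: "int p dvd a (Suc e)" if "e < d" for e
    using that
  proof (induction "d - e" arbitrary: e rule: less_induct)
    case less
    have "b e = a (Suc e) + (\<Sum>i\<in>{Suc (Suc e)..d}. a i * y ^ (i - e - 1))"
      using less.prems by (simp add: b_def sum.atLeast_Suc_atMost)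
    moreover have "int p dvd (\<Sum>i\<in>{Suc (Suc e)..d}. a i * y ^ (i - e - 1))"
    proof (rule dvd_sum)
      fix i assume "i \<in> {Suc (Suc e)..d}"
      then have "int p dvd a (Suc (i - 1))" by (intro less.hyps) auto
      then show "int p dvd a i * y ^ (i - e - 1)" using \<open>i \<in> _\<close> by simp
    qed
    ultimately show ?case using b[OF less.prems] by (simp add: dvd_add_left_iff)
  qed
  have "int p dvd a 0 + (\<Sum>e<d. y ^ Suc e * a (Suc e))"
    using Suc.prems(4)[OF y] by (simp only: sum.lessThan_Suc_shift power_0 mult_1)
  moreover have "int p dvd (\<Sum>e<d. y ^ Suc e * a (Suc e))"
    using a_b by (intro dvd_sum dvd_mult) auto
  ultimately have "int p dvd a 0" by (simp only: dvd_add_left_iff)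
  then show ?case using a_b Suc.prems(5) by (cases e) auto
qed simp

text \<open>Counting replaces inverse matrices: there are \<open>p ^ card I\<close> residue vectors
  on either side, so an injective map between them is onto.\<close>

lemma injective_imp_surjective_mod:
  fixes A :: "'j \<Rightarrow> 'i \<Rightarrow> int"
  assumes p: "0 < p" and fin: "finite I" "finite J" "card I = card J"
    and inj: "\<And>w i. (\<And>j. j \<in> J \<Longrightarrow> int p dvd (\<Sum>i\<in>I. A j i * w i)) \<Longrightarrow> i \<in> I \<Longrightarrow> int p dvd w i"
  shows "\<exists>w. \<forall>j\<in>J. int p dvd (\<Sum>i\<in>I. A j i * w i) - u j"
proof -
  define f where "f = (\<lambda>w j. if j \<in> J then (\<Sum>i\<in>I. A j i * w i) mod int p else 0)"
  have "inj_on f (residue_vectors p I)"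
  proof (rule inj_onI)
    fix w w' assume w: "w \<in> residue_vectors p I" "w' \<in> residue_vectors p I" and eq: "f w = f w'"
    have "int p dvd (\<Sum>i\<in>I. A j i * (w i - w' i))" if "j \<in> J" for j
      using fun_cong[OF eq, of j] that
      by (simp add: f_def mod_eq_dvd_iff right_diff_distrib sum_subtractf)
    then have "int p dvd w i - w' i" if "i \<in> I" for i using inj[of "\<lambda>i. w i - w' i"] that by blast
    then show "w = w'" using residue_vectors_eqI[OF w] by blast
  qed
  moreover have "f ` residue_vectors p I \<subseteq> residue_vectors p J"
    using p by (auto simp: f_def residue_vectors_iff)
  moreover have "card (residue_vectors p I) = card (residue_vectors p J)"
    using fin by (simp add: card_residue_vectors)
  ultimately have surj: "f ` residue_vectors p I = residue_vectors p J"
    using fin by (intro card_subset_eq) (auto simp: card_image finite_residue_vectors)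
  have "(\<lambda>j. if j \<in> J then u j mod int p else 0) \<in> residue_vectors p J"
    using p by (simp add: residue_vectors_iff)
  then obtain w where "f w = (\<lambda>j. if j \<in> J then u j mod int p else 0)"
    unfolding surj[symmetric] by (elim imageE) simp
  note w = fun_cong[OF this]
  have "int p dvd (\<Sum>i\<in>I. A j i * w i) - u j" if "j \<in> J" for j
    using w[of j] that by (simp add: f_def mod_eq_dvd_iff)
  then show ?thesis by blast
qed

lemma MDS_columns_span:
  assumes "is_MDS_gen p N K G" "0 < p" "S \<subseteq> {1..N}" "card S = K"
  shows "\<exists>a. \<forall>k\<in>{1..K}. int p dvd (\<Sum>n\<in>S. G k n * a n) - u k"
proof (rule injective_imp_surjective_mod)
  show "finite S" using assms(3) finite_subset by blast
  show "int p dvd w i" if "\<And>k. k \<in> {1..K} \<Longrightarrow> int p dvd (\<Sum>n\<in>S. G k n * w n)" "i \<in> S" for w i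
  proof -
    have "(\<forall>k\<in>{1..K}. (\<Sum>n\<in>S. w n * G k n) mod int p = 0) \<longrightarrow> (\<forall>n\<in>S. w n mod int p = 0)"
      using assms(1,3,4) unfolding is_MDS_gen_def by blast
    then show ?thesis using that by (simp add: mult.commute dvd_eq_mod_eq_0)
  qed
qed (use assms in auto)

lemma MDS_rows_independent:
  assumes "is_MDS_gen p N K G" "0 < p" "S \<subseteq> {1..N}" "card S = K"
    and z: "\<And>n. n \<in> S \<Longrightarrow> int p dvd (\<Sum>k=1..K. z k * G k n)" and k: "k \<in> {1..K}"
  shows "int p dvd z k"
proof -
  \<comment> \<open>The columns in \<open>S\<close> combine to the \<open>k\<close>-th unit vector;
    the same combination of the vanishing products leaves \<open>z k\<close>.\<close>
  obtain a where a: "\<forall>k'\<in>{1..K}. int p dvd (\<Sum>n\<in>S. G k' n * a n) - (if k' = k then 1 else 0)"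
    using MDS_columns_span[OF assms(1-4), of "\<lambda>k'. if k' = k then 1 else 0"] by blast
  have "(\<Sum>n\<in>S. a n * (\<Sum>k'=1..K. z k' * G k' n)) = (\<Sum>k'=1..K. z k' * (\<Sum>n\<in>S. G k' n * a n))"
    unfolding sum_distrib_left by (subst sum.swap) (simp add: mult_ac)
  moreover have "z k = (\<Sum>k'=1..K. z k' * (if k' = k then 1 else 0))"
    using k by (simp add: if_distrib cong: if_cong)
  moreover have "int p dvd (\<Sum>n\<in>S. a n * (\<Sum>k'=1..K. z k' * G k' n))"
    by (rule dvd_sum, rule dvd_mult, rule z)
  moreover have "int p dvd (\<Sum>k'=1..K. z k' * (\<Sum>n\<in>S. G k' n * a n)) - (\<Sum>k'=1..K. z k' * (if k' = k then 1 else 0))"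
    unfolding sum_subtractf[symmetric] right_diff_distrib[symmetric]
    using a by (intro dvd_sum dvd_mult) auto
  ultimately show ?thesis by (metis dvd_diff diff_diff_eq2 add_diff_cancel_left')
qed

text \<open>Adding multiples of \<open>h\<close> to the rows of a file shifts what server
  \<open>n\<close> stores by any chosen amount, which will make its answers uniform. Completing
  \<open>n\<close> to \<open>K\<close> servers gives a square system to solve.\<close>

lemma MDS_column_nonzero:
  assumes "is_MDS_gen p N K G" "0 < p" "0 < K" "K \<le> N" "n \<in> {1..N}"
  shows "\<exists>h. int p dvd (\<Sum>k=1..K. G k n * h k) - 1"
proof -
  have "K - 1 \<le> card ({1..N} - {n})" using assms by simp
  from obtain_subset_with_card_n[OF this]
  obtain S' where S': "S' \<subseteq> {1..N} - {n}" "card S' = K - 1" by metis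
  then have "finite S'" using finite_subset by fast
  moreover have "n \<notin> S'" using S' by blast
  ultimately have S: "card (insert n S') = K" "insert n S' \<subseteq> {1..N}" "finite (insert n S')"
    using S' assms by auto
  have "\<exists>h. \<forall>n'\<in>insert n S'. int p dvd (\<Sum>k\<in>{1..K}. G k n' * h k) - 1"
  proof (rule injective_imp_surjective_mod)
    show "int p dvd w i" if "\<And>j. j \<in> insert n S' \<Longrightarrow> int p dvd (\<Sum>k\<in>{1..K}. G k j * w k)" "i \<in> {1..K}" for w i
      using MDS_rows_independent[OF assms(1,2) S(2,1), of w i] that by (simp add: mult.commute)
  qed (use S assms in auto)
  then show ?thesis by blast
qed

section \<open>The interference code\<close>

text \<open>Any \<open>d\<close> rows of the Vandermonde matrix are independent. The points start at
  1, not 0, because \<open>mix_kernel\<close> has to cancel a power of the point.\<close>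

lemma vandermonde_mod:
  fixes y :: "nat \<Rightarrow> int"
  assumes "prime p" "X \<subseteq> {..<q}" "q < p" "card X = d"
    and "\<And>t. t \<in> X \<Longrightarrow> int p dvd (\<Sum>e<d. int (t + 1) ^ e * y e)" and "e < d"
  shows "int p dvd y e"
proof (rule prime_dvd_poly_coeffs[of p "(\<lambda>t. int (t + 1)) ` X"])
  show "finite ((\<lambda>t. int (t + 1)) ` X)" using assms(2) finite_subset by auto
  show "card ((\<lambda>t. int (t + 1)) ` X) = d" using assms(4) by (simp add: card_image inj_on_def)
  fix u v assume uv: "u \<in> (\<lambda>t. int (t + 1)) ` X" "v \<in> (\<lambda>t. int (t + 1)) ` X" "u \<noteq> v"
  then obtain x x' where x: "u = int (x + 1)" "v = int (x' + 1)" "x \<in> X" "x' \<in> X" by blast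
  then have "x < p" "x' < p" using assms(2,3) by auto
  then have "\<bar>u - v\<bar> < int p" "u - v \<noteq> 0" using x uv(3) by auto
  then show "\<not> int p dvd u - v" using zdvd_not_zless[of "\<bar>u - v\<bar>" "int p"] by auto
qed (use assms in auto)

lemma mult_add_less: "g * c + x < n * c" if "g < n" "x < c" for g c x n :: nat
proof -
  have "g * c + x < Suc g * c" using that by simp
  also have "\<dots> \<le> n * c" using that by (intro mult_le_mono1) simp
  finally show ?thesis .
qed

lemma card_div_mod_square:
  fixes a :: nat
  assumes "A \<subseteq> {..<a}" "B \<subseteq> {..<a}"
  shows "card {t. t < a * a \<and> t div a \<in> A \<and> t mod a \<in> B} = card A * card B"
proof -
  have "{t. t < a * a \<and> t div a \<in> A \<and> t mod a \<in> B} = (\<lambda>(s, x). s * a + x) ` (A \<times> B)"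
  proof (intro equalityI subsetI)
    fix t assume "t \<in> {t. t < a * a \<and> t div a \<in> A \<and> t mod a \<in> B}"
    then show "t \<in> (\<lambda>(s, x). s * a + x) ` (A \<times> B)"
      by (intro image_eqI[of _ _ "(t div a, t mod a)"]) auto
  next
    fix t assume "t \<in> (\<lambda>(s, x). s * a + x) ` (A \<times> B)"
    then obtain s x where t: "t = s * a + x" "s \<in> A" "x \<in> B" by auto
    then have "s < a" "x < a" using assms by auto
    then have "s * a + x < a * a" by (rule mult_add_less)
    then show "t \<in> {t. t < a * a \<and> t div a \<in> A \<and> t mod a \<in> B}"
      using t \<open>x < a\<close> by auto
  qed
  moreover have "inj_on (\<lambda>(s, x). s * a + x) (A \<times> B)"
  proof (rule inj_onI, clarify)
    fix s x s' x' assume *: "s * a + x = s' * a + x'" "x \<in> B" "x' \<in> B"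
    then have "x < a" "x' < a" using assms by auto
    then show "s = s' \<and> x = x'"
      using arg_cong[OF *(1), of "\<lambda>t. t div a"] arg_cong[OF *(1), of "\<lambda>t. t mod a"] by simp
  qed
  ultimately show ?thesis by (simp add: card_image card_cartesian_product)
qed

lemma sum_Pow_binomial:
  fixes x y :: nat
  assumes "finite A"
  shows "(\<Sum>B\<in>Pow A. x ^ card B * y ^ card (A - B)) = (x + y) ^ card A"
  using prod_add[OF assms, of "\<lambda>_. x" "\<lambda>_. y"] by simp

lemma sum_lessThan_add:
  fixes f :: "nat \<Rightarrow> int"
  shows "(\<Sum>e<m + n. f e) = (\<Sum>e<m. f e) + (\<Sum>e<n. f (m + e))"
  by (induction n) auto

type_synonym slot = "nat \<times> nat set \<times> nat"

locale collusion_code =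
  fixes p M a b :: nat
  assumes p: "prime p" and a_p: "a * a < p" and b_pos: "0 < b" and b_less: "b < a"
begin

section \<open>Slots, groups and the code on a group\<close>

text \<open>Chosen so that adding any file \<open>i\<close> to a nonempty \<open>\<Lambda>\<close>
  multiplies the count by \<open>(a - b) / b\<close>, the ratio of mixed to pure interference slots
  in a group. It depends on \<open>card \<Lambda>\<close> only, so the shape of the request hides
  the wanted file.\<close>

definition reps :: "nat set \<Rightarrow> nat" where
  "reps \<Lambda> = (a - b) ^ (card \<Lambda> - 1) * b ^ (M - card \<Lambda>)"

text \<open>Slot \<open>(s, \<Lambda>, r)\<close> is the \<open>r\<close>-th symbol asked from virtual server \<open>s\<close> that is a sum of one
  symbol from each of the files in \<open>\<Lambda>\<close>.\<close>

definition slots :: "slot set" where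
  "slots = {(s, \<Lambda>, r). s < a \<and> \<Lambda> \<subseteq> {1..M} \<and> \<Lambda> \<noteq> {} \<and> r < reps \<Lambda>}"

definition slots_of :: "nat \<Rightarrow> slot set" where
  "slots_of m = {(s, \<Lambda>, r) \<in> slots. m \<in> \<Lambda>}"

text \<open>When file \<open>i\<close> is wanted, the \<open>\<Lambda>\<close>-slots and \<open>insert i \<Lambda>\<close>-slots with \<open>i \<notin> \<Lambda>\<close> are split into groups
  \<open>(\<Lambda>, g)\<close> of \<open>a * a\<close> slots each; slot number \<open>e\<close> of a group belongs to virtual server \<open>e div a\<close>,
  and to \<open>\<Lambda>\<close> (pure interference) iff \<open>e mod a < b\<close>.\<close>

definition group_reps :: "nat set \<Rightarrow> nat" where
  "group_reps \<Lambda> = (a - b) ^ (card \<Lambda> - 1) * b ^ (M - Suc (card \<Lambda>))"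

definition groups :: "nat \<Rightarrow> (nat set \<times> nat) set" where
  "groups i = {(\<Lambda>, g). \<Lambda> \<subseteq> {1..M} - {i} \<and> \<Lambda> \<noteq> {} \<and> g < group_reps \<Lambda>}"

text \<open>Group \<open>g\<close> takes the \<open>g\<close>-th run of \<open>b\<close> indices
  among the \<open>\<Lambda>\<close>-slots of each server and the \<open>g\<close>-th run of
  \<open>a - b\<close> among the \<open>insert i \<Lambda>\<close>-slots; by
  \<open>reps_group\<close> the runs tile both ranges exactly.\<close>

definition row :: "nat \<Rightarrow> nat set \<times> nat \<Rightarrow> nat \<Rightarrow> slot" where
  "row i = (\<lambda>(\<Lambda>, g) e. if e mod a < b then (e div a, \<Lambda>, g * b + e mod a)
     else (e div a, insert i \<Lambda>, g * (a - b) + (e mod a - b)))"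

text \<open>Together with \<open>pos\<close> it inverts \<open>row\<close>, except on slots with
  \<open>\<Lambda> = {i}\<close>, which carry no interference and belong to no group.\<close>

definition grp :: "nat \<Rightarrow> slot \<Rightarrow> nat set \<times> nat" where
  "grp i = (\<lambda>(s, \<Lambda>, r). if i \<in> \<Lambda> then (\<Lambda> - {i}, r div (a - b)) else (\<Lambda>, r div b))"

definition pos :: "nat \<Rightarrow> slot \<Rightarrow> nat" where
  "pos i = (\<lambda>(s, \<Lambda>, r). s * a + (if i \<in> \<Lambda> then b + r mod (a - b) else r mod b))"

lemma reps_group:
  assumes "\<Lambda> \<subseteq> {1..M} - {i}" "\<Lambda> \<noteq> {}" "i \<in> {1..M}"
  shows "reps \<Lambda> = group_reps \<Lambda> * b" "reps (insert i \<Lambda>) = group_reps \<Lambda> * (a - b)"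
proof -
  have fin: "finite \<Lambda>" using assms(1) finite_subset by auto
  have "card \<Lambda> \<le> card ({1..M} - {i})" using assms(1) by (intro card_mono) auto
  then have "card \<Lambda> \<le> M - 1" "0 < M" using assms(3) by auto
  then have less: "card \<Lambda> < M" by linarith
  have pos: "0 < card \<Lambda>" using fin assms(2) by (simp add: card_gt_0_iff)
  have "M - card \<Lambda> = Suc (M - Suc (card \<Lambda>))" using less by simp
  then show "reps \<Lambda> = group_reps \<Lambda> * b" by (simp add: reps_def group_reps_def)
  have "i \<notin> \<Lambda>" using assms(1) by auto
  then have "card (insert i \<Lambda>) = Suc (card \<Lambda>)" using fin by simp
  moreover have "card \<Lambda> = Suc (card \<Lambda> - 1)" using pos by simp
  ultimately show "reps (insert i \<Lambda>) = group_reps \<Lambda> * (a - b)"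
    unfolding reps_def group_reps_def by (metis diff_Suc_1 power_Suc mult.assoc mult.commute)
qed

lemma row_in_slots:
  assumes "i \<in> {1..M}" "c \<in> groups i" "e < a * a"
  shows "row i c e \<in> slots"
proof -
  obtain \<Lambda> g where c: "c = (\<Lambda>, g)" "\<Lambda> \<subseteq> {1..M} - {i}" "\<Lambda> \<noteq> {}" "g < group_reps \<Lambda>"
    using assms(2) by (auto simp: groups_def)
  have s: "e div a < a" using assms(3) by (simp add: less_mult_imp_div_less)
  note rg = reps_group[OF c(2,3) assms(1)]
  show ?thesis
  proof (cases "e mod a < b")
    case True
    have "g * b + e mod a < reps \<Lambda>" unfolding rg using c(4) True by (rule mult_add_less)
    then show ?thesis using c s True by (auto simp: row_def slots_def)
  next
    case False
    moreover have "e mod a < a" using b_less by simp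
    ultimately have "e mod a - b < a - b" by linarith
    with c(4) have "g * (a - b) + (e mod a - b) < reps (insert i \<Lambda>)" unfolding rg by (rule mult_add_less)
    then show ?thesis using c s False assms(1) unfolding c(1) row_def slots_def by auto
  qed
qed

lemma grp_row:
  assumes "c \<in> groups i"
  shows "grp i (row i c e) = c" "pos i (row i c e) = e"
proof -
  obtain \<Lambda> g where c: "c = (\<Lambda>, g)" "\<Lambda> \<subseteq> {1..M} - {i}" using assms by (auto simp: groups_def)
  have i: "i \<notin> \<Lambda>" using c by auto
  have "grp i (row i c e) = c \<and> pos i (row i c e) = e"
  proof (cases "e mod a < b")
    case True
    then show ?thesis using c(1) i by (simp add: grp_def row_def pos_def)
  next
    case False
    define x where "x = e mod a - b"
    have x: "e mod a = b + x" "x < a - b"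
      using False mod_less_divisor[of a e] b_less unfolding x_def by linarith+
    have "row i c e = (e div a, insert i \<Lambda>, g * (a - b) + x)" using False by (simp add: row_def c(1) x_def)
    then show ?thesis using x i c(1) by (simp add: grp_def pos_def x(1)[symmetric])
  qed
  then show "grp i (row i c e) = c" "pos i (row i c e) = e" by simp_all
qed

lemma row_grp:
  assumes "i \<in> {1..M}" "(s, \<Lambda>, r) \<in> slots" "\<Lambda> \<noteq> {i}"
  shows "grp i (s, \<Lambda>, r) \<in> groups i" "fst (grp i (s, \<Lambda>, r)) = \<Lambda> - {i}"
    "pos i (s, \<Lambda>, r) < a * a" "row i (grp i (s, \<Lambda>, r)) (pos i (s, \<Lambda>, r)) = (s, \<Lambda>, r)"
proof -
  have s: "s < a" and \<Lambda>: "\<Lambda> - {i} \<subseteq> {1..M} - {i}" "\<Lambda> - {i} \<noteq> {}" and r: "r < reps \<Lambda>"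
    using assms by (auto simp: slots_def)
  note rg = reps_group[OF \<Lambda> assms(1)]
  have x: "b + r mod (a - b) < a" using mod_less_divisor[of "a - b" r] b_less by linarith
  have x': "r mod b < b" using b_pos by simp
  show "fst (grp i (s, \<Lambda>, r)) = \<Lambda> - {i}" by (auto simp: grp_def)
  show "pos i (s, \<Lambda>, r) < a * a"
    using s x x' b_less by (auto simp: pos_def intro!: mult_add_less)
  show "grp i (s, \<Lambda>, r) \<in> groups i"
  proof (cases "i \<in> \<Lambda>")
    case True
    then have "insert i (\<Lambda> - {i}) = \<Lambda>" by blast
    then have "r < group_reps (\<Lambda> - {i}) * (a - b)" using rg(2) r by simp
    then show ?thesis using True \<Lambda> by (auto simp: grp_def groups_def less_mult_imp_div_less)
  next
    case False
    then have "\<Lambda> - {i} = \<Lambda>" by blast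
    then show ?thesis using False \<Lambda> rg(1) r by (auto simp: grp_def groups_def less_mult_imp_div_less)
  qed
  show "row i (grp i (s, \<Lambda>, r)) (pos i (s, \<Lambda>, r)) = (s, \<Lambda>, r)"
    using x x' b_less div_mult_mod_eq[of r "a - b"] by (auto simp: grp_def row_def pos_def insert_absorb)
qed

text \<open>The Vandermonde codeword whose message is the first \<open>d\<close> entries of
  \<open>y\<close> on the group. Message and codeword share one index set, so encoding maps a column
  of a key to a column of the same shape.\<close>

definition code :: "nat \<Rightarrow> nat \<Rightarrow> (slot \<Rightarrow> int) \<Rightarrow> slot \<Rightarrow> int" where
  "code i d y \<sigma> = (\<Sum>e<d. int (pos i \<sigma> + 1) ^ e * y (row i (grp i \<sigma>) e))"

text \<open>For the servers in \<open>V\<close> this is what the code used for interference produces. Lengthening the code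
  elsewhere makes the map invertible without changing what the servers in \<open>V\<close> see.\<close>

definition mix :: "nat \<Rightarrow> nat set \<Rightarrow> nat \<Rightarrow> (slot \<Rightarrow> int) \<Rightarrow> slot \<Rightarrow> int" where
  "mix i V m y \<sigma> = (if m = i then y \<sigma> else code i (if fst \<sigma> \<in> V then a * b else a * a) y \<sigma>)"

lemma slots_of_subset: "slots_of m \<subseteq> slots"
  by (auto simp: slots_of_def)

text \<open>The slots of a group differ in their file sets only by \<open>i\<close>; hence an
  interfering file meets all of a group or none, and can be encoded on its own.\<close>

lemma row_in_slots_of:
  assumes "i \<in> {1..M}" "c \<in> groups i" "e < a * a" "m \<in> fst c"
  shows "row i c e \<in> slots_of m"
  using row_in_slots[OF assms(1-3)] assms(4)
  by (auto simp: slots_of_def row_def split: prod.splits if_splits)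

text \<open>On a group the system is block triangular: the \<open>a * b\<close> rows of the servers
  in \<open>V\<close> involve only the first \<open>a * b\<close> unknowns. Both diagonal blocks are
  square Vandermonde matrices, the second up to nonzero row factors.\<close>

lemma mix_kernel:
  assumes i: "i \<in> {1..M}" and V: "V \<subseteq> {..<a}" "card V = b"
    and ker: "\<And>\<sigma>. \<sigma> \<in> slots_of m \<Longrightarrow> int p dvd mix i V m y \<sigma>" and \<sigma>: "\<sigma> \<in> slots_of m"
  shows "int p dvd y \<sigma>"
proof (cases "m = i")
  case True
  then show ?thesis using ker[OF \<sigma>] by (simp add: mix_def)
next
  case False
  obtain s \<Lambda> r where srl: "\<sigma> = (s, \<Lambda>, r)" by (cases \<sigma>)
  have in_slots: "(s, \<Lambda>, r) \<in> slots" and m: "m \<in> \<Lambda>" using \<sigma> srl by (auto simp: slots_of_def)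
  then have "\<Lambda> \<noteq> {i}" using False by auto
  note rg = row_grp[OF i in_slots this]
  define c where "c = grp i \<sigma>"
  define Y where "Y = (\<lambda>e. y (row i c e))"
  have c: "c \<in> groups i" "m \<in> fst c" using rg m False by (auto simp: c_def srl)
  have eqs: "int p dvd (\<Sum>e<(if t div a \<in> V then a * b else a * a). int (t + 1) ^ e * Y e)"
    if "t < a * a" for t
  proof -
    have "fst (row i c t) = t div a" by (simp add: row_def split: prod.splits)
    then show ?thesis
      using ker[OF row_in_slots_of[OF i c(1) that c(2)]] False
      by (simp add: mix_def code_def grp_row[OF c(1)] Y_def)
  qed
  have low: "int p dvd Y e" if "e < a * b" for e
  proof (rule vandermonde_mod[OF p _ a_p])
    have "{t. t < a * a \<and> t div a \<in> V \<and> t mod a \<in> {..<a}} = {t. t < a * a \<and> t div a \<in> V}"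
      using b_less by auto
    then show "card {t. t < a * a \<and> t div a \<in> V} = a * b"
      using card_div_mod_square[of V a "{..<a}"] V by (simp add: mult.commute)
    show "int p dvd (\<Sum>e<a * b. int (t + 1) ^ e * Y e)" if "t \<in> {t. t < a * a \<and> t div a \<in> V}" for t
      using eqs[of t] that by simp
  qed (use that in auto)
  have ab: "a * a = a * b + a * (a - b)" using b_less by (simp add: distrib_left[symmetric])
  have high: "int p dvd Y (a * b + e)" if "e < a * (a - b)" for e
  proof (rule vandermonde_mod[OF p _ a_p, where y = "\<lambda>e. Y (a * b + e)"])
    have "{t. t < a * a \<and> t div a \<in> {..<a} - V \<and> t mod a \<in> {..<a}} = {t. t < a * a \<and> t div a \<notin> V}"
      using b_less by (auto simp: less_mult_imp_div_less)
    moreover have "card ({..<a} - V) = a - b"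
      using V by (subst card_Diff_subset) (auto intro: finite_subset)
    ultimately show "card {t. t < a * a \<and> t div a \<notin> V} = a * (a - b)"
      using card_div_mod_square[of "{..<a} - V" a "{..<a}"] by (simp add: mult.commute)
    show "int p dvd (\<Sum>e<a * (a - b). int (t + 1) ^ e * Y (a * b + e))"
      if t: "t \<in> {t. t < a * a \<and> t div a \<notin> V}" for t
    proof -
      have "int p dvd (\<Sum>e<a * a. int (t + 1) ^ e * Y e)" using eqs[of t] t by simp
      also have "(\<Sum>e<a * a. int (t + 1) ^ e * Y e) = (\<Sum>e<a * b. int (t + 1) ^ e * Y e)
          + (\<Sum>e<a * (a - b). int (t + 1) ^ (a * b + e) * Y (a * b + e))"
        unfolding ab by (rule sum_lessThan_add)
      finally have "int p dvd (\<Sum>e<a * b. int (t + 1) ^ e * Y e)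
          + (\<Sum>e<a * (a - b). int (t + 1) ^ (a * b + e) * Y (a * b + e))" .
      moreover have "int p dvd (\<Sum>e<a * b. int (t + 1) ^ e * Y e)"
        using low by (intro dvd_sum dvd_mult) auto
      ultimately have "int p dvd (\<Sum>e<a * (a - b). int (t + 1) ^ (a * b + e) * Y (a * b + e))"
        by (simp only: dvd_add_right_iff)
      also have "\<dots> = int (t + 1) ^ (a * b) * (\<Sum>e<a * (a - b). int (t + 1) ^ e * Y (a * b + e))"
        by (simp only: sum_distrib_left power_add mult.assoc)
      finally have "int p dvd int (t + 1) ^ (a * b) \<or> int p dvd (\<Sum>e<a * (a - b). int (t + 1) ^ e * Y (a * b + e))"
        using p by (simp add: prime_dvd_mult_iff)
      \<comment> \<open>The row factor is a unit, since
        \<open>0 < t + 1 \<le> a * a < p\<close>.\<close>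
      moreover have "\<not> int p dvd int (t + 1) ^ (a * b)"
      proof
        assume "int p dvd int (t + 1) ^ (a * b)"
        then have "int p dvd int (t + 1)" using p prime_dvd_power[of "int p"] by simp
        then show False using t a_p zdvd_imp_le[of "int p" "int (t + 1)"] by simp
      qed
      ultimately show ?thesis by blast
    qed
  qed (use that in auto)
  have "int p dvd Y (pos i \<sigma>)"
  proof (cases "pos i \<sigma> < a * b")
    case False
    then show ?thesis using high[of "pos i \<sigma> - a * b"] rg(3) ab by (simp add: srl)
  qed (rule low)
  then show ?thesis using rg(4) by (simp add: Y_def c_def srl)
qed

text \<open>To be applied to the difference of two file collections with equal answers. All
  interfering files use one code, so their sum is again a codeword; it vanishes at the pure
  interference slots, hence its message vanishes, and with it the interference in the mixed
  slots.\<close>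

lemma interference_cancels:
  assumes i: "i \<in> {1..M}"
    and eq: "\<And>s \<Lambda> r. (s, \<Lambda>, r) \<in> slots \<Longrightarrow>
      int p dvd (\<Sum>m\<in>\<Lambda>. if m = i then z m (s, \<Lambda>, r) else code i (a * b) (z m) (s, \<Lambda>, r))"
    and \<sigma>: "\<sigma> \<in> slots_of i"
  shows "int p dvd z i \<sigma>"
proof -
  obtain s \<Lambda> r where srl: "\<sigma> = (s, \<Lambda>, r)" by (cases \<sigma>)
  have in_slots: "(s, \<Lambda>, r) \<in> slots" and m: "i \<in> \<Lambda>" using \<sigma> srl by (auto simp: slots_of_def)
  have fin: "finite \<Lambda>" using in_slots finite_subset by (auto simp: slots_def)
  have split: "(\<Sum>m\<in>\<Lambda>. if m = i then z m (s, \<Lambda>, r) else code i (a * b) (z m) (s, \<Lambda>, r))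
      = z i \<sigma> + (\<Sum>m\<in>\<Lambda> - {i}. code i (a * b) (z m) \<sigma>)"
    using sum.remove[OF fin m, of "\<lambda>m. if m = i then z m (s, \<Lambda>, r) else code i (a * b) (z m) (s, \<Lambda>, r)"]
    by (simp add: srl)
  have code_sum: "(\<Sum>m\<in>B. code i (a * b) (z m) \<tau>) = (\<Sum>e<a * b. int (pos i \<tau> + 1) ^ e * (\<Sum>m\<in>B. z m (row i (grp i \<tau>) e)))"
    for B \<tau> unfolding code_def sum_distrib_left by (rule sum.swap)
  have "int p dvd (\<Sum>m\<in>\<Lambda> - {i}. code i (a * b) (z m) \<sigma>)"
  proof (cases "\<Lambda> = {i}")
    case False
    note rg = row_grp[OF i in_slots False]
    define c where "c = grp i \<sigma>"
    define Y where "Y = (\<lambda>e. \<Sum>m\<in>\<Lambda> - {i}. z m (row i c e))"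
    have c: "c \<in> groups i" "fst c = \<Lambda> - {i}" using rg by (auto simp: c_def srl)
    have "int p dvd Y e" if "e < a * b" for e
    proof (rule vandermonde_mod[OF p _ a_p])
      \<comment> \<open>The pure interference positions: \<open>b\<close> for each of
        \<open>a\<close> servers, exactly the dimension of the code.\<close>
      have "{t. t < a * a \<and> t div a \<in> {..<a} \<and> t mod a \<in> {..<b}} = {t. t < a * a \<and> t mod a < b}"
        by (auto simp: less_mult_imp_div_less)
      then show "card {t. t < a * a \<and> t mod a < b} = a * b"
        using card_div_mod_square[of "{..<a}" a "{..<b}"] b_less by simp
      fix t assume t: "t \<in> {t. t < a * a \<and> t mod a < b}"
      obtain \<tau> r' where \<tau>: "row i c t = \<tau>" "\<tau> = (t div a, \<Lambda> - {i}, r')"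
        using t c(2) by (cases c) (auto simp: row_def)
      have "\<tau> \<in> slots" unfolding \<tau>(1)[symmetric] using t by (intro row_in_slots[OF i c(1)]) simp
      from eq[OF this[unfolded \<tau>(2)]]
      have "int p dvd (\<Sum>m\<in>\<Lambda> - {i}. code i (a * b) (z m) \<tau>)"
        unfolding \<tau>(2) by (subst (asm) sum.cong[OF refl, of _ _ "\<lambda>m. code i (a * b) (z m) (t div a, \<Lambda> - {i}, r')"]) auto
      then show "int p dvd (\<Sum>e<a * b. int (t + 1) ^ e * Y e)"
        using grp_row[OF c(1), of t] by (simp add: code_sum \<tau>(1) Y_def)
    qed (use that in auto)
    then show ?thesis unfolding code_sum Y_def c_def by (intro dvd_sum, intro dvd_mult) simp
  qed simp
  then show ?thesis using eq[OF in_slots] unfolding split by (simp only: dvd_add_left_iff)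
qed

section \<open>Counting slots\<close>

lemma reps_insert:
  assumes "\<Lambda> \<subseteq> {1..M} - {m}" "m \<in> {1..M}"
  shows "reps (insert m \<Lambda>) = (a - b) ^ card \<Lambda> * b ^ card ({1..M} - {m} - \<Lambda>)"
proof -
  have fin: "finite \<Lambda>" using assms(1) finite_subset by auto
  have "m \<notin> \<Lambda>" using assms(1) by auto
  then have "card (insert m \<Lambda>) = Suc (card \<Lambda>)" using fin by simp
  moreover have "card ({1..M} - {m} - \<Lambda>) = M - Suc (card \<Lambda>)"
    using assms fin by (simp add: card_Diff_subset)
  ultimately show ?thesis by (simp add: reps_def)
qed

lemma card_slots_eq:
  assumes "A \<subseteq> Pow {1..M} - {{}}"
  shows "card {(s, \<Lambda>, r). s \<in> {..<a} \<and> \<Lambda> \<in> A \<and> r < reps \<Lambda>} = a * (\<Sum>\<Lambda>\<in>A. reps \<Lambda>)"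
proof -
  have "finite A" using assms by (rule finite_subset) simp
  moreover have "{(s, \<Lambda>, r). s \<in> {..<a} \<and> \<Lambda> \<in> A \<and> r < reps \<Lambda>} = {..<a} \<times> (SIGMA \<Lambda>:A. {..<reps \<Lambda>})"
    by auto
  ultimately show ?thesis by (simp add: card_cartesian_product)
qed

text \<open>Per virtual server, \<open>reps\<close> runs through the terms of
  \<open>((a - b) + b) ^ (M - 1)\<close>, expanded over the subsets of the other files.\<close>

lemma card_slots_of:
  assumes m: "m \<in> {1..M}"
  shows "card (slots_of m) = a ^ M"
proof -
  let ?A = "insert m ` Pow ({1..M} - {m})"
  have mem: "\<Lambda> \<in> ?A \<longleftrightarrow> \<Lambda> \<subseteq> {1..M} \<and> m \<in> \<Lambda>" for \<Lambda>
  proof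
    assume "\<Lambda> \<subseteq> {1..M} \<and> m \<in> \<Lambda>"
    then show "\<Lambda> \<in> ?A" by (intro image_eqI[of _ _ "\<Lambda> - {m}"]) auto
  qed (use m in auto)
  have "slots_of m = {(s, \<Lambda>, r). s \<in> {..<a} \<and> \<Lambda> \<in> ?A \<and> r < reps \<Lambda>}"
    unfolding mem by (auto simp: slots_of_def slots_def)
  moreover have "?A \<subseteq> Pow {1..M} - {{}}" using m by auto
  ultimately have "card (slots_of m) = a * (\<Sum>\<Lambda>\<in>?A. reps \<Lambda>)" by (simp only: card_slots_eq)
  also have "(\<Sum>\<Lambda>\<in>?A. reps \<Lambda>) = (\<Sum>\<Lambda>\<in>Pow ({1..M} - {m}). reps (insert m \<Lambda>))"
    by (rule sum.reindex[unfolded comp_def]) (auto simp: inj_on_def)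
  also have "\<dots> = (\<Sum>\<Lambda>\<in>Pow ({1..M} - {m}). (a - b) ^ card \<Lambda> * b ^ card ({1..M} - {m} - \<Lambda>))"
    using m by (intro sum.cong refl reps_insert) auto
  also have "\<dots> = (a - b + b) ^ card ({1..M} - {m})" by (rule sum_Pow_binomial) simp
  also have "\<dots> = a ^ (M - 1)" using m b_less by simp
  also have "a * a ^ (M - 1) = a ^ M" using m by (simp add: power_eq_if)
  finally show ?thesis .
qed

text \<open>The factor \<open>a - b\<close> repairs the exponent \<open>card \<Lambda> - 1\<close>,
  and \<open>b ^ M\<close> supplies the term of the empty set, so the binomial theorem applies to
  all subsets of \<open>{1..M}\<close>.\<close>

lemma card_slots: "(a - b) * card slots + a * b ^ M = a * a ^ M"
proof -
  let ?A = "Pow {1..M} - {{}}"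
  have "slots = {(s, \<Lambda>, r). s \<in> {..<a} \<and> \<Lambda> \<in> ?A \<and> r < reps \<Lambda>}"
    by (auto simp: slots_def)
  then have "card slots = a * (\<Sum>\<Lambda>\<in>?A. reps \<Lambda>)" by (simp only: card_slots_eq[OF order_refl])
  moreover have "(a - b) * (\<Sum>\<Lambda>\<in>?A. reps \<Lambda>) = (\<Sum>\<Lambda>\<in>?A. (a - b) ^ card \<Lambda> * b ^ card ({1..M} - \<Lambda>))"
    unfolding sum_distrib_left
  proof (intro sum.cong refl)
    fix \<Lambda> assume \<Lambda>: "\<Lambda> \<in> ?A"
    then have "finite \<Lambda>" using finite_subset by auto
    then have "0 < card \<Lambda>" "card ({1..M} - \<Lambda>) = M - card \<Lambda>"
      using \<Lambda> by (auto simp: card_Diff_subset card_gt_0_iff)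
    then show "(a - b) * reps \<Lambda> = (a - b) ^ card \<Lambda> * b ^ card ({1..M} - \<Lambda>)"
      by (simp add: reps_def power_eq_if[of _ "card \<Lambda>"])
  qed
  moreover have "(\<Sum>\<Lambda>\<in>?A. (a - b) ^ card \<Lambda> * b ^ card ({1..M} - \<Lambda>)) + b ^ M = a ^ M"
    using sum_Pow_binomial[of "{1..M}" "a - b" b] b_less sum.remove[of "Pow {1..M}" "{}" "\<lambda>\<Lambda>. (a - b) ^ card \<Lambda> * b ^ card ({1..M} - \<Lambda>)"]
    by simp
  ultimately show ?thesis by (metis distrib_left mult.left_commute)
qed

lemma finite_slots: "finite slots"
proof -
  have "slots = {..<a} \<times> (SIGMA \<Lambda>:Pow {1..M} - {{}}. {..<reps \<Lambda>})"
    by (auto simp: slots_def)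
  then show ?thesis by simp
qed

lemma finite_slots_of: "finite (slots_of m)"
  using finite_slots slots_of_subset by (rule finite_subset[rotated])

text \<open>For each file \<open>m\<close>, the matrix \<open>U m\<close> is invertible modulo \<open>p\<close>; it is square since
  \<open>card (slots_of m) = a ^ M\<close>.\<close>

definition keys :: "(nat \<Rightarrow> slot \<Rightarrow> nat \<Rightarrow> int) set" where
  "keys = {U. (\<forall>m \<sigma> l. (m \<in> {1..M} \<and> \<sigma> \<in> slots_of m \<and> l \<in> {1..a ^ M} \<longrightarrow> 0 \<le> U m \<sigma> l \<and> U m \<sigma> l < int p)
        \<and> (\<not> (m \<in> {1..M} \<and> \<sigma> \<in> slots_of m \<and> l \<in> {1..a ^ M}) \<longrightarrow> U m \<sigma> l = 0)) \<and>
     (\<forall>m\<in>{1..M}. \<forall>w. (\<forall>\<sigma>\<in>slots_of m. int p dvd (\<Sum>l=1..a ^ M. U m \<sigma> l * w l)) \<longrightarrow> (\<forall>l\<in>{1..a ^ M}. int p dvd w l))}"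

lemma keys_range:
  assumes "U \<in> keys"
  shows "m \<in> {1..M} \<Longrightarrow> \<sigma> \<in> slots_of m \<Longrightarrow> l \<in> {1..a ^ M} \<Longrightarrow> 0 \<le> U m \<sigma> l \<and> U m \<sigma> l < int p"
    and "\<not> (m \<in> {1..M} \<and> \<sigma> \<in> slots_of m \<and> l \<in> {1..a ^ M}) \<Longrightarrow> U m \<sigma> l = 0"
  using assms unfolding keys_def by blast+

lemma keys_kernel:
  assumes "U \<in> keys" "m \<in> {1..M}" "\<And>\<sigma>. \<sigma> \<in> slots_of m \<Longrightarrow> int p dvd (\<Sum>l=1..a ^ M. U m \<sigma> l * w l)"
    and "l \<in> {1..a ^ M}"
  shows "int p dvd w l"
  using assms unfolding keys_def by blast

lemma p_pos: "0 < p" using p by (simp add: prime_gt_0_nat)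

lemma finite_keys: "finite keys"
proof -
  let ?I = "{1..M} \<times> slots \<times> {1..a ^ M}"
  have "keys \<subseteq> (\<lambda>v m \<sigma> l. v (m, \<sigma>, l)) ` residue_vectors p ?I"
  proof
    fix U assume U: "U \<in> keys"
    have "(\<lambda>(m, \<sigma>, l). U m \<sigma> l) \<in> residue_vectors p ?I"
      unfolding residue_vectors_iff
    proof clarify
      fix m s \<Lambda> r l
      show "((m, (s, \<Lambda>, r), l) \<in> ?I \<longrightarrow> 0 \<le> U m (s, \<Lambda>, r) l \<and> U m (s, \<Lambda>, r) l < int p)
          \<and> ((m, (s, \<Lambda>, r), l) \<notin> ?I \<longrightarrow> U m (s, \<Lambda>, r) l = 0)"
        using keys_range[OF U, of m "(s, \<Lambda>, r)" l] slots_of_subset[of m] p_pos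
        by (cases "m \<in> {1..M} \<and> (s, \<Lambda>, r) \<in> slots_of m \<and> l \<in> {1..a ^ M}") auto
    qed
    then show "U \<in> (\<lambda>v m \<sigma> l. v (m, \<sigma>, l)) ` residue_vectors p ?I"
      by (rule rev_image_eqI) simp
  qed
  then show ?thesis by (rule finite_subset) (simp add: finite_residue_vectors finite_slots)
qed

lemma keys_nonempty: "keys \<noteq> {}"
proof -
  have "\<exists>h. bij_betw h (slots_of m) {1..a ^ M}" if "m \<in> {1..M}" for m
    by (rule finite_same_card_bij) (use that card_slots_of finite_slots_of in auto)
  then obtain h where h: "\<And>m. m \<in> {1..M} \<Longrightarrow> bij_betw (h m) (slots_of m) {1..a ^ M}"
    by metis
  \<comment> \<open>A permutation matrix for each file, available because its slots and its rows are
    equinumerous.\<close>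
  define U where "U = (\<lambda>m \<sigma> l. if m \<in> {1..M} \<and> \<sigma> \<in> slots_of m \<and> l \<in> {1..a ^ M} \<and> l = h m \<sigma> then 1 else 0 :: int)"
  have "int p dvd w l"
    if m: "m \<in> {1..M}" and ker: "\<forall>\<sigma>\<in>slots_of m. int p dvd (\<Sum>l=1..a ^ M. U m \<sigma> l * w l)"
      and l: "l \<in> {1..a ^ M}" for m w l
  proof -
    have "l \<in> h m ` slots_of m" using h[OF m] l by (simp add: bij_betw_def)
    then obtain \<sigma> where \<sigma>: "\<sigma> \<in> slots_of m" "l = h m \<sigma>" by (elim imageE)
    have "(\<Sum>l'=1..a ^ M. U m \<sigma> l' * w l') = (\<Sum>l'=1..a ^ M. if l = l' then w l' else 0)"
      using m \<sigma> by (intro sum.cong refl) (auto simp: U_def)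
    also have "\<dots> = w l" using l by (subst sum.delta') auto
    finally show ?thesis using ker \<sigma>(1) by metis
  qed
  moreover have "1 < int p" using prime_gt_1_nat[OF p] by simp
  ultimately have "U \<in> keys" unfolding keys_def by (auto simp: U_def)
  then show ?thesis by blast
qed

section \<open>The action of the code on keys\<close>

definition rekey :: "nat \<Rightarrow> nat set \<Rightarrow> (nat \<Rightarrow> slot \<Rightarrow> nat \<Rightarrow> int) \<Rightarrow> nat \<Rightarrow> slot \<Rightarrow> nat \<Rightarrow> int" where
  "rekey i V U = (\<lambda>m \<sigma> l. if m \<in> {1..M} \<and> \<sigma> \<in> slots_of m \<and> l \<in> {1..a ^ M}
      then mix i V m (\<lambda>\<tau>. U m \<tau> l) \<sigma> mod int p else 0)"

lemma mix_diff: "mix i V m (\<lambda>\<tau>. y \<tau> - y' \<tau>) \<sigma> = mix i V m y \<sigma> - mix i V m y' \<sigma>"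
  by (simp add: mix_def code_def right_diff_distrib sum_subtractf)

lemma code_sum: "code i d (\<lambda>\<tau>. \<Sum>l\<in>A. y \<tau> l * w l) \<sigma> = (\<Sum>l\<in>A. code i d (\<lambda>\<tau>. y \<tau> l) \<sigma> * w l)"
  unfolding code_def sum_distrib_left sum_distrib_right by (subst sum.swap) (simp add: mult.assoc)

lemma mix_sum: "mix i V m (\<lambda>\<tau>. \<Sum>l\<in>A. y \<tau> l * w l) \<sigma> = (\<Sum>l\<in>A. mix i V m (\<lambda>\<tau>. y \<tau> l) \<sigma> * w l)"
  by (simp add: mix_def code_sum)

lemma dvd_sum_mod_mult:
  "int p dvd (\<Sum>l\<in>A. f l mod int p * w l) \<longleftrightarrow> int p dvd (\<Sum>l\<in>A. f l * w l)"
proof -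
  have "(\<Sum>l\<in>A. f l mod int p * w l) mod int p = (\<Sum>l\<in>A. f l * w l) mod int p"
    by (subst (1 2) mod_sum_eq[symmetric]) (simp add: mod_mult_left_eq)
  then show ?thesis by (simp add: dvd_eq_mod_eq_0)
qed

text \<open>By \<open>mix_kernel\<close> the matrix of \<open>mix\<close> has trivial kernel, so
  multiplying by it preserves invertibility and is injective; finiteness of \<open>keys\<close>
  gives the rest.\<close>

lemma rekey_bij:
  assumes i: "i \<in> {1..M}" and V: "V \<subseteq> {..<a}" "card V = b"
  shows "bij_betw (rekey i V) keys keys"
proof -
  have "rekey i V ` keys \<subseteq> keys"
  proof (intro image_subsetI)
    fix U assume U: "U \<in> keys"
    have "int p dvd w l"
      if m: "m \<in> {1..M}" and ker: "\<forall>\<sigma>\<in>slots_of m. int p dvd (\<Sum>l=1..a ^ M. rekey i V U m \<sigma> l * w l)"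
        and l: "l \<in> {1..a ^ M}" for m w l
    proof (rule keys_kernel[OF U m _ l])
      fix \<sigma> assume "\<sigma> \<in> slots_of m"
      show "int p dvd (\<Sum>l=1..a ^ M. U m \<sigma> l * w l)"
      proof (rule mix_kernel[OF i V, of m])
        fix \<tau> assume \<tau>: "\<tau> \<in> slots_of m"
        have "int p dvd (\<Sum>l=1..a ^ M. mix i V m (\<lambda>\<tau>. U m \<tau> l) \<tau> mod int p * w l)"
          using ker[rule_format, OF \<tau>] m \<tau> by (simp add: rekey_def)
        then show "int p dvd mix i V m (\<lambda>\<sigma>. \<Sum>l=1..a ^ M. U m \<sigma> l * w l) \<tau>"
          by (simp only: dvd_sum_mod_mult mix_sum)
      qed fact
    qed
    then show "rekey i V U \<in> keys" using p_pos unfolding keys_def by (auto simp: rekey_def)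
  qed
  moreover have "inj_on (rekey i V) keys"
  proof (rule inj_onI, intro ext)
    fix U U' m \<sigma> l assume U: "U \<in> keys" "U' \<in> keys" and eq: "rekey i V U = rekey i V U'"
    show "U m \<sigma> l = U' m \<sigma> l"
    proof (cases "m \<in> {1..M} \<and> \<sigma> \<in> slots_of m \<and> l \<in> {1..a ^ M}")
      case True
      have "int p dvd U m \<sigma> l - U' m \<sigma> l"
      proof (rule mix_kernel[OF i V, of m])
        fix \<tau> assume \<tau>: "\<tau> \<in> slots_of m"
        have "rekey i V U m \<tau> l = rekey i V U' m \<tau> l" using eq by simp
        then show "int p dvd mix i V m (\<lambda>\<sigma>. U m \<sigma> l - U' m \<sigma> l) \<tau>"
          using True \<tau> by (simp add: rekey_def mix_diff mod_eq_dvd_iff)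
      qed (use True in simp)
      then have "U m \<sigma> l mod int p = U' m \<sigma> l mod int p" by (simp add: mod_eq_dvd_iff)
      then show ?thesis using keys_range(1)[OF U(1), of m \<sigma> l] keys_range(1)[OF U(2), of m \<sigma> l] True by simp
    next
      case False
      then show ?thesis by (simp only: keys_range(2)[OF U(1) False] keys_range(2)[OF U(2) False])
    qed
  qed
  ultimately show ?thesis
    using endo_inj_surj[OF finite_keys] by (simp add: bij_betw_def)
qed

lemma keys_surjective:
  assumes "U \<in> keys"
  shows "\<exists>w. \<forall>(s, \<Lambda>, r)\<in>slots. int p dvd (\<Sum>m\<in>\<Lambda>. \<Sum>l=1..a ^ M. U m (s, \<Lambda>, r) l * w m l) - v (s, \<Lambda>, r)"
proof -
  \<comment> \<open>Let one file of each sum, the least, carry the whole prescribed value and the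
    others nothing. The system then splits into one square invertible system per file.\<close>
  define u where "u = (\<lambda>m (s, \<Lambda>, r). if m = Min \<Lambda> then v (s, \<Lambda>, r) else 0 :: int)"
  have "\<exists>w. \<forall>\<sigma>\<in>slots_of m. int p dvd (\<Sum>l=1..a ^ M. U m \<sigma> l * w l) - u m \<sigma>" if m: "m \<in> {1..M}" for m
  proof (rule injective_imp_surjective_mod)
    show "int p dvd w l" if "\<And>\<sigma>. \<sigma> \<in> slots_of m \<Longrightarrow> int p dvd (\<Sum>l=1..a ^ M. U m \<sigma> l * w l)" "l \<in> {1..a ^ M}" for w l
      using keys_kernel[OF assms m] that by blast
  qed (use p_pos finite_slots_of card_slots_of[OF m] in auto)
  then obtain w where w: "\<And>m \<sigma>. m \<in> {1..M} \<Longrightarrow> \<sigma> \<in> slots_of m \<Longrightarrow> int p dvd (\<Sum>l=1..a ^ M. U m \<sigma> l * w m l) - u m \<sigma>"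
    by metis
  show ?thesis
  proof (rule exI[of _ w], clarify)
    fix s \<Lambda> r assume sl: "(s, \<Lambda>, r) \<in> slots"
    then have \<Lambda>: "\<Lambda> \<subseteq> {1..M}" "\<Lambda> \<noteq> {}" by (auto simp: slots_def)
    then have fin: "finite \<Lambda>" using finite_subset by auto
    have "(\<Sum>m\<in>\<Lambda>. u m (s, \<Lambda>, r)) = v (s, \<Lambda>, r)"
      using fin \<Lambda>(2) by (simp add: u_def)
    moreover have "int p dvd (\<Sum>m\<in>\<Lambda>. (\<Sum>l=1..a ^ M. U m (s, \<Lambda>, r) l * w m l) - u m (s, \<Lambda>, r))"
      using sl \<Lambda>(1) by (intro dvd_sum w) (auto simp: slots_of_def)
    ultimately show "int p dvd (\<Sum>m\<in>\<Lambda>. \<Sum>l=1..a ^ M. U m (s, \<Lambda>, r) l * w m l) - v (s, \<Lambda>, r)"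
      by (simp add: sum_subtractf)
  qed
qed

end

section \<open>Schemes over MDS-coded storage\<close>

locale MDS_storage = collusion_code +
  fixes N K T :: nat and G :: "nat \<Rightarrow> nat \<Rightarrow> int" and blk :: "nat \<Rightarrow> nat set"
  assumes MDS: "is_MDS_gen p N K G" and K: "0 < K" "K \<le> N" and T: "0 < T" "T \<le> N" and M_pos: "0 < M"
    and blk: "bij_betw blk {..<a} {B. B \<subseteq> {1..N} \<and> card B = K}"
    and b_eq: "b = a - ((N - T) choose K)"
begin

section \<open>Blocks as virtual servers: queries, decoding, laws of answers\<close>

definition seen :: "nat set \<Rightarrow> nat set" where
  "seen S = {s. s < a \<and> blk s \<inter> S \<noteq> {}}"

lemma blk_subset: "s < a \<Longrightarrow> blk s \<subseteq> {1..N}" and card_blk: "s < a \<Longrightarrow> card (blk s) = K"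
  using blk by (auto simp: bij_betw_def)

text \<open>The blocks avoiding \<open>S\<close> are the \<open>K\<close>-subsets of the other
  \<open>N - T\<close> servers.\<close>

lemma card_seen:
  assumes "S \<subseteq> {1..N}" "card S = T"
  shows "card (seen S) = b"
proof -
  let ?C = "{B. B \<subseteq> {1..N} - S \<and> card B = K}"
  let ?D = "{s. s < a \<and> blk s \<inter> S = {}}"
  have fin: "finite S" using assms(1) finite_subset by auto
  have img: "blk ` ?D = ?C"
  proof (intro equalityI subsetI)
    fix B assume B: "B \<in> ?C"
    then have "B \<in> blk ` {..<a}" using blk by (auto simp: bij_betw_def)
    then show "B \<in> blk ` ?D" using B by blast
  next
    fix B assume "B \<in> blk ` ?D"
    then obtain s where "s < a" "blk s \<inter> S = {}" "B = blk s" by blast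
    then show "B \<in> ?C" using blk_subset[of s] card_blk[of s] by auto
  qed
  have inj: "inj_on blk ?D"
    using bij_betw_imp_inj_on[OF blk] by (rule inj_on_subset) auto
  have "card ?D = card ?C" using card_image[OF inj] unfolding img by (rule sym)
  also have "\<dots> = (N - T) choose K"
    using card_Diff_subset[OF fin assms(1)] assms(2) by (simp add: n_subsets)
  finally have D: "card ?D = (N - T) choose K" .
  have "seen S = {..<a} - ?D" by (auto simp: seen_def)
  moreover have "card ({..<a} - ?D) = card {..<a} - card ?D" by (rule card_Diff_subset) auto
  ultimately have "card (seen S) = a - card ?D" by simp
  then show ?thesis by (simp add: D b_eq)
qed

definition asked :: "nat \<Rightarrow> slot set" where
  "asked n = {\<sigma> \<in> slots. n \<in> blk (fst \<sigma>)}"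

definition query :: "nat \<Rightarrow> nat \<Rightarrow> (nat \<Rightarrow> slot \<Rightarrow> nat \<Rightarrow> int) \<Rightarrow> slot \<Rightarrow> nat \<Rightarrow> nat \<Rightarrow> int" where
  "query i n U = (\<lambda>\<sigma> m l. if \<sigma> \<in> asked n \<and> m \<in> {1..M} \<and> \<sigma> \<in> slots_of m \<and> l \<in> {1..a ^ M}
     then (if m = i then U m \<sigma> l else code i (a * b) (\<lambda>\<tau>. U m \<tau> l) \<sigma> mod int p) else 0)"

text \<open>The query without an index: every file is treated like the wanted one. Up to a bijection of the
  keys, any \<open>T\<close> servers see this whatever the wanted file is.\<close>

definition raw_query :: "nat \<Rightarrow> (nat \<Rightarrow> slot \<Rightarrow> nat \<Rightarrow> int) \<Rightarrow> slot \<Rightarrow> nat \<Rightarrow> nat \<Rightarrow> int" where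
  "raw_query n U = (\<lambda>\<sigma> m l. if \<sigma> \<in> asked n then U m \<sigma> l else 0)"

definition answer :: "nat \<Rightarrow> (slot \<Rightarrow> nat \<Rightarrow> nat \<Rightarrow> int) \<Rightarrow> (nat \<Rightarrow> nat \<Rightarrow> int) \<Rightarrow> slot \<Rightarrow> int" where
  "answer n q y = (\<lambda>\<sigma>. if \<sigma> \<in> asked n
     then (\<Sum>m\<in>fst (snd \<sigma>). \<Sum>l=1..a ^ M. q \<sigma> m l * y m l) mod int p else 0)"

text \<open>Every slot asked of \<open>n\<close> belongs to a virtual server in
  \<open>seen S\<close>, where \<open>mix\<close> uses the length \<open>a * b\<close>, as
  \<open>query\<close> does everywhere.\<close>

lemma query_eq_raw_query:
  assumes "i \<in> {1..M}" "U \<in> keys" "n \<in> S"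
  shows "query i n U = raw_query n (rekey i (seen S) U)"
proof (intro ext)
  fix \<sigma> m l
  have "fst \<sigma> \<in> seen S" if "\<sigma> \<in> asked n"
    using that assms(3) by (auto simp: asked_def seen_def slots_def)
  then show "query i n U \<sigma> m l = raw_query n (rekey i (seen S) U) \<sigma> m l"
    using keys_range(1)[OF assms(2), of m \<sigma> l]
    by (auto simp: query_def raw_query_def rekey_def mix_def)
qed

lemma cong_stored:
  assumes "m \<in> {1..M}" "l \<in> {1..a ^ M}"
  shows "[stored p M (a ^ M) K G W n m l = (\<Sum>k=1..K. W m l k * G k n)] (mod int p)"
  using assms by (simp add: stored_def cong_def)

lemma cong_answer:
  assumes "\<sigma> \<in> asked n"
  shows "[answer n q (stored p M (a ^ M) K G W n) \<sigma>
    = (\<Sum>m\<in>fst (snd \<sigma>). \<Sum>l=1..a ^ M. q \<sigma> m l * (\<Sum>k=1..K. W m l k * G k n))] (mod int p)"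
proof -
  have "fst (snd \<sigma>) \<subseteq> {1..M}" using assms by (auto simp: asked_def slots_def)
  then have "[(\<Sum>m\<in>fst (snd \<sigma>). \<Sum>l=1..a ^ M. q \<sigma> m l * stored p M (a ^ M) K G W n m l)
    = (\<Sum>m\<in>fst (snd \<sigma>). \<Sum>l=1..a ^ M. q \<sigma> m l * (\<Sum>k=1..K. W m l k * G k n))] (mod int p)"
    by (intro cong_sum cong_mult cong_refl cong_stored) auto
  then show ?thesis using assms by (simp add: answer_def)
qed

text \<open>Linearity reduces this to differences, one column \<open>k\<close> of the files at a
  time: a block undoes the storage code, \<open>interference_cancels\<close> removes the other
  files, and the key matrix of file \<open>i\<close> has trivial kernel.\<close>

lemma decodable:
  assumes i: "i \<in> {1..M}" and U: "U \<in> keys"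
    and W: "W \<in> files p M (a ^ M) K" "W' \<in> files p M (a ^ M) K"
    and eq: "\<And>n. n \<in> {1..N} \<Longrightarrow> answer n (query i n U) (stored p M (a ^ M) K G W n)
      = answer n (query i n U) (stored p M (a ^ M) K G W' n)"
  shows "W i = W' i"
proof (intro ext)
  fix l k
  show "W i l k = W' i l k"
  proof (cases "l \<in> {1..a ^ M} \<and> k \<in> {1..K}")
    case True
    define z where "z = (\<lambda>m \<tau>. \<Sum>l=1..a ^ M. U m \<tau> l * (W m l k - W' m l k))"
    have "int p dvd W i l k - W' i l k"
    proof (rule keys_kernel[OF U i, where w = "\<lambda>l. W i l k - W' i l k"])
      fix \<sigma> assume \<sigma>: "\<sigma> \<in> slots_of i"
      have "int p dvd z i \<sigma>"
      proof (rule interference_cancels[OF i _ \<sigma>, where z = z])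
        fix s \<Lambda> r assume sl: "(s, \<Lambda>, r) \<in> slots"
        let ?\<tau> = "(s, \<Lambda>, r)"
        have s: "s < a" and \<Lambda>: "\<Lambda> \<subseteq> {1..M}" using sl by (auto simp: slots_def)
        \<comment> \<open>Query coefficients before reduction. They do not involve \<open>n\<close>,
          so all \<open>K\<close> servers of the block evaluate the same combination of
          rows.\<close>
        define q where "q = (\<lambda>m l. if m = i then U m ?\<tau> l else code i (a * b) (\<lambda>\<tau>. U m \<tau> l) ?\<tau>)"
        have "int p dvd (\<Sum>m\<in>\<Lambda>. \<Sum>l=1..a ^ M. q m l * (W m l k - W' m l k))"
        proof (rule MDS_rows_independent[OF MDS p_pos blk_subset[OF s] card_blk[OF s],
              where z = "\<lambda>k. \<Sum>m\<in>\<Lambda>. \<Sum>l=1..a ^ M. q m l * (W m l k - W' m l k)"])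
          fix n assume n: "n \<in> blk s"
          then have n': "n \<in> {1..N}" "?\<tau> \<in> asked n" using blk_subset[OF s] sl by (auto simp: asked_def)
          have q: "[query i n U ?\<tau> m l = q m l] (mod int p)" if "m \<in> \<Lambda>" "l \<in> {1..a ^ M}" for m l
            using that \<Lambda> sl n' by (auto simp: query_def q_def slots_of_def cong_def)
          have ans: "[(\<Sum>m\<in>\<Lambda>. \<Sum>l=1..a ^ M. q m l * (\<Sum>k=1..K. V m l k * G k n))
              = answer n (query i n U) (stored p M (a ^ M) K G V n) ?\<tau>] (mod int p)" for V
          proof -
            have *: "[(\<Sum>m\<in>\<Lambda>. \<Sum>l=1..a ^ M. query i n U ?\<tau> m l * (\<Sum>k=1..K. V m l k * G k n))
              = (\<Sum>m\<in>\<Lambda>. \<Sum>l=1..a ^ M. q m l * (\<Sum>k=1..K. V m l k * G k n))] (mod int p)"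
              by (intro cong_sum cong_mult cong_refl q)
            have "[answer n (query i n U) (stored p M (a ^ M) K G V n) ?\<tau>
              = (\<Sum>m\<in>\<Lambda>. \<Sum>l=1..a ^ M. query i n U ?\<tau> m l * (\<Sum>k=1..K. V m l k * G k n))] (mod int p)"
              using cong_answer[OF n'(2), of "query i n U" V] by simp
            from cong_sym[OF cong_trans[OF this *]] show ?thesis .
          qed
          have "[(\<Sum>m\<in>\<Lambda>. \<Sum>l=1..a ^ M. q m l * (\<Sum>k=1..K. W m l k * G k n))
              = (\<Sum>m\<in>\<Lambda>. \<Sum>l=1..a ^ M. q m l * (\<Sum>k=1..K. W' m l k * G k n))] (mod int p)"
            by (rule cong_trans[OF ans[of W, unfolded eq[OF n'(1)]] cong_sym[OF ans[of W']]])
          then have "int p dvd (\<Sum>m\<in>\<Lambda>. \<Sum>l=1..a ^ M. q m l * (\<Sum>k=1..K. (W m l k - W' m l k) * G k n))"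
            by (simp add: cong_iff_dvd_diff sum_subtractf right_diff_distrib left_diff_distrib)
          also have "\<dots> = (\<Sum>m\<in>\<Lambda>. \<Sum>l=1..a ^ M. \<Sum>k=1..K. q m l * (W m l k - W' m l k) * G k n)"
            by (simp only: sum_distrib_left mult.assoc)
          also have "\<dots> = (\<Sum>m\<in>\<Lambda>. \<Sum>k=1..K. \<Sum>l=1..a ^ M. q m l * (W m l k - W' m l k) * G k n)"
            by (intro sum.cong refl sum.swap)
          also have "\<dots> = (\<Sum>k=1..K. \<Sum>m\<in>\<Lambda>. \<Sum>l=1..a ^ M. q m l * (W m l k - W' m l k) * G k n)"
            by (rule sum.swap)
          finally show "int p dvd (\<Sum>k=1..K. (\<Sum>m\<in>\<Lambda>. \<Sum>l=1..a ^ M. q m l * (W m l k - W' m l k)) * G k n)"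
            by (simp only: sum_distrib_right)
        qed (use True in blast)
        also have "(\<Sum>m\<in>\<Lambda>. \<Sum>l=1..a ^ M. q m l * (W m l k - W' m l k))
            = (\<Sum>m\<in>\<Lambda>. if m = i then z m ?\<tau> else code i (a * b) (z m) ?\<tau>)"
          by (intro sum.cong refl) (simp add: q_def z_def code_sum)
        finally show "int p dvd (\<Sum>m\<in>\<Lambda>. if m = i then z m ?\<tau> else code i (a * b) (z m) ?\<tau>)" .
      qed
      then show "int p dvd (\<Sum>l=1..a ^ M. U i \<sigma> l * (W i l k - W' i l k))" by (simp add: z_def)
    qed (use True in blast)
    then have "W i l k mod int p = W' i l k mod int p" by (simp add: mod_eq_dvd_iff)
    moreover have "0 \<le> W i l k \<and> W i l k < int p" "0 \<le> W' i l k \<and> W' i l k < int p"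
      using W True i by (auto simp: files_def)
    ultimately show ?thesis by simp
  next
    case False
    then have "W i l k = 0" "W' i l k = 0" using W unfolding files_def by blast+
    then show ?thesis by simp
  qed
qed

lemma answers_uniform:
  assumes n: "n \<in> {1..N}" and U: "U \<in> keys"
  shows "map_pmf (\<lambda>W. answer n (raw_query n U) (stored p M (a ^ M) K G W n)) (pmf_of_set (files p M (a ^ M) K))
    = pmf_of_set (residue_vectors p (asked n))"
proof (rule map_pmf_files_translation[OF p_pos])
  let ?f = "\<lambda>W. answer n (raw_query n U) (stored p M (a ^ M) K G W n)"
  show "finite (residue_vectors p (asked n))"
    by (rule finite_residue_vectors) (auto simp: asked_def finite_slots)
  have range: "?f W \<in> residue_vectors p (asked n)" for W
    using p_pos by (auto simp: residue_vectors_iff answer_def)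
  then show "?f ` files p M (a ^ M) K \<subseteq> residue_vectors p (asked n)" by blast
  fix v v' assume v: "v \<in> residue_vectors p (asked n)" "v' \<in> residue_vectors p (asked n)"
  obtain w where w: "\<forall>(s, \<Lambda>, r)\<in>slots. int p dvd
      (\<Sum>m\<in>\<Lambda>. \<Sum>l=1..a ^ M. U m (s, \<Lambda>, r) l * w m l) - (v' (s, \<Lambda>, r) - v (s, \<Lambda>, r))"
    using keys_surjective[OF U, of "\<lambda>\<sigma>. v' \<sigma> - v \<sigma>"] by blast
  obtain h where h: "int p dvd (\<Sum>k=1..K. G k n * h k) - 1"
    using MDS_column_nonzero[OF MDS p_pos K n] by blast
  show "\<exists>W0. \<forall>W\<in>files p M (a ^ M) K. ?f W = v \<longrightarrow>
      ?f (file_residue p M (a ^ M) K (\<lambda>m j k. W m j k + W0 m j k)) = v'"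
  \<comment> \<open>Since \<open>h\<close> pairs to 1 with column \<open>n\<close>, this adds
    \<open>w\<close> to what server \<open>n\<close> stores, and \<open>w\<close> was chosen to move
    the requested sums from \<open>v\<close> to \<open>v'\<close>.\<close>
  proof (rule exI[of _ "\<lambda>m j k. w m j * h k"], intro ballI impI)
    fix W assume fW: "?f W = v"
    let ?W = "file_residue p M (a ^ M) K (\<lambda>m j k. W m j k + w m j * h k)"
    show "?f ?W = v'"
    proof (rule residue_vectors_eqI[OF range v(2)])
      fix \<sigma> assume \<sigma>: "\<sigma> \<in> asked n"
      then have sl: "\<sigma> \<in> slots" by (simp add: asked_def)
      let ?S = "\<lambda>y. \<Sum>m\<in>fst (snd \<sigma>). \<Sum>l=1..a ^ M. U m \<sigma> l * y m l"
      have raw: "[?f V \<sigma> = ?S (\<lambda>m l. \<Sum>k=1..K. V m l k * G k n)] (mod int p)" for V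
        using cong_answer[OF \<sigma>, of "raw_query n U" V] \<sigma> by (simp add: raw_query_def)
      have y: "[(\<Sum>k=1..K. ?W m l k * G k n) = (\<Sum>k=1..K. W m l k * G k n) + w m l] (mod int p)"
        if "m \<in> {1..M}" "l \<in> {1..a ^ M}" for m l
      proof -
        have "[(\<Sum>k=1..K. ?W m l k * G k n) = (\<Sum>k=1..K. (W m l k + w m l * h k) * G k n)] (mod int p)"
          using that by (intro cong_sum cong_mult cong_refl) (simp add: file_residue_def cong_def)
        also have "(\<Sum>k=1..K. (W m l k + w m l * h k) * G k n)
            = (\<Sum>k=1..K. W m l k * G k n) + w m l * (\<Sum>k=1..K. G k n * h k)"
          by (simp add: sum.distrib sum_distrib_left algebra_simps)
        also have "[(\<Sum>k=1..K. W m l k * G k n) + w m l * (\<Sum>k=1..K. G k n * h k)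
            = (\<Sum>k=1..K. W m l k * G k n) + w m l * 1] (mod int p)"
          using h by (intro cong_add cong_mult cong_refl) (simp add: cong_iff_dvd_diff)
        finally show ?thesis by simp
      qed
      have "[?f ?W \<sigma> = ?S (\<lambda>m l. \<Sum>k=1..K. ?W m l k * G k n)] (mod int p)" by (rule raw)
      also have "[?S (\<lambda>m l. \<Sum>k=1..K. ?W m l k * G k n) = ?S (\<lambda>m l. (\<Sum>k=1..K. W m l k * G k n) + w m l)] (mod int p)"
        using sl by (intro cong_sum cong_mult cong_refl y) (auto simp: slots_def)
      also have "?S (\<lambda>m l. (\<Sum>k=1..K. W m l k * G k n) + w m l) = ?S (\<lambda>m l. \<Sum>k=1..K. W m l k * G k n) + ?S w"
        by (simp add: distrib_left sum.distrib)
      also have "[\<dots> = v \<sigma> + (v' \<sigma> - v \<sigma>)] (mod int p)"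
      proof (rule cong_add)
        show "[?S (\<lambda>m l. \<Sum>k=1..K. W m l k * G k n) = v \<sigma>] (mod int p)"
          using raw[of W] fW by (simp add: cong_sym)
        show "[?S w = v' \<sigma> - v \<sigma>] (mod int p)"
          using w sl by (cases \<sigma>) (auto simp: cong_iff_dvd_diff)
      qed
      finally show "int p dvd ?f ?W \<sigma> - v' \<sigma>" by (simp add: cong_iff_dvd_diff)
    qed
  qed
qed

section \<open>The rate\<close>

lemma sum_card_asked: "(\<Sum>n=1..N. card (asked n)) = K * card slots"
proof -
  have "(\<Sum>n=1..N. card (asked n)) = (\<Sum>n=1..N. \<Sum>\<sigma>\<in>slots. if n \<in> blk (fst \<sigma>) then 1 else 0)"
    unfolding asked_def using finite_slots by (simp add: sum.If_cases Int_def)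
  also have "\<dots> = (\<Sum>\<sigma>\<in>slots. \<Sum>n=1..N. if n \<in> blk (fst \<sigma>) then 1 else 0)" by (rule sum.swap)
  also have "\<dots> = (\<Sum>\<sigma>\<in>slots. K)"
  proof (rule sum.cong[OF refl])
    fix \<sigma> assume "\<sigma> \<in> slots"
    then have s: "fst \<sigma> < a" by (auto simp: slots_def)
    then have "{1..N} \<inter> blk (fst \<sigma>) = blk (fst \<sigma>)" using blk_subset by blast
    then show "(\<Sum>n=1..N. if n \<in> blk (fst \<sigma>) then 1 else 0) = K"
      using card_blk[OF s] by (simp add: sum.If_cases)
  qed
  finally show ?thesis by simp
qed

lemma PIR_scheme_exists:
  "\<exists>PF PG qry ans. is_PIR_scheme p N K T M (a ^ M) G PF PG qry ans \<and>
    (\<forall>i\<in>{1..M}. PIR_rate p N K M (a ^ M) G PF PG qry ans i = 1 / (\<Sum>m<M. (real b / real a) ^ m))"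
proof -
  have p1: "1 < p" using p by (rule prime_gt_1_nat)
  have fin: "finite (asked n)" for n by (auto simp: asked_def finite_slots)
  have "\<exists>PF PG qry ans. is_PIR_scheme p N K T M (a ^ M) G PF PG qry ans \<and>
    (\<forall>i\<in>{1..M}. PIR_rate p N K M (a ^ M) G PF PG qry ans i = real (a ^ M * K)
      / (\<Sum>n=1..N. log (real p) (real (card (residue_vectors p (asked n))))))"
  proof (rule PIR_scheme_of_finite_scheme[OF T M_pos p1 finite_keys keys_nonempty,
        where answer = answer and raw = raw_query])
    fix S i assume S: "S \<subseteq> {1..N}" "card S = T" and i: "i \<in> {1..M}"
    have "bij_betw (rekey i (seen S)) keys keys"
      by (rule rekey_bij[OF i _ card_seen[OF S]]) (auto simp: seen_def)
    then show "\<exists>\<phi>. bij_betw \<phi> keys keys \<and> (\<forall>U\<in>keys. \<forall>n\<in>S. query i n U = raw_query n (\<phi> U))"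
      using query_eq_raw_query[OF i] by blast
  next
    show "residue_vectors p (asked n) \<noteq> {}" for n
      using card_residue_vectors[OF fin, of p n] p_pos by auto
  qed (use decodable answers_uniform finite_residue_vectors[OF fin] in blast)+
  moreover have "real (a ^ M * K) / (\<Sum>n=1..N. log (real p) (real (card (residue_vectors p (asked n)))))
      = 1 / (\<Sum>m<M. (real b / real a) ^ m)"
  proof -
    have "(\<Sum>n=1..N. log (real p) (real (card (residue_vectors p (asked n))))) = (\<Sum>n=1..N. real (card (asked n)))"
      using p1 by (simp add: card_residue_vectors fin log_nat_power)
    also have "\<dots> = real K * real (card slots)"
      unfolding of_nat_sum[symmetric] sum_card_asked by simp
    finally have 1: "(\<Sum>n=1..N. log (real p) (real (card (residue_vectors p (asked n))))) = real K * real (card slots)" .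
    let ?\<rho> = "real b / real a"
    have a: "0 < real a" "0 < real a - real b" using b_less by auto
    \<comment> \<open>Dividing by \<open>a - b\<close> will turn the slot count into
      \<open>a ^ M\<close> times the geometric sum in \<open>b / a\<close>.\<close>
    have "real ((a - b) * card slots + a * b ^ M) = real (a * a ^ M)" using card_slots by simp
    then have "(real a - real b) * real (card slots) = real a * real a ^ M - real a * real b ^ M"
      using b_less by (simp add: of_nat_diff)
    also have "\<dots> = real a ^ M * (real a * (1 - ?\<rho> ^ M))"
      using a by (simp add: power_divide field_simps)
    also have "1 - ?\<rho> ^ M = (1 - ?\<rho>) * (\<Sum>m<M. ?\<rho> ^ m)" by (rule one_diff_power_eq)
    also have "real a ^ M * (real a * ((1 - ?\<rho>) * (\<Sum>m<M. ?\<rho> ^ m)))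
        = real a ^ M * ((real a * (1 - ?\<rho>)) * (\<Sum>m<M. ?\<rho> ^ m))" by (simp only: mult.assoc)
    also have "real a * (1 - ?\<rho>) = real a - real b" using a by (simp add: right_diff_distrib)
    also have "real a ^ M * ((real a - real b) * (\<Sum>m<M. ?\<rho> ^ m))
        = (real a - real b) * (real a ^ M * (\<Sum>m<M. ?\<rho> ^ m))" by (rule mult.left_commute)
    finally have "real (card slots) = real a ^ M * (\<Sum>m<M. ?\<rho> ^ m)" using a by simp
    then show ?thesis unfolding 1 using a K by simp
  qed
  ultimately show ?thesis by simp
qed

end

theorem theorem1:
  fixes N K T M :: nat
  assumes "0 < N" and "0 < K" and "0 < T" and "0 < M"
    and "K \<le> N" and "T \<le> N" and "T + K \<le> N"
  shows "\<exists>q0::nat. \<forall>p::nat. prime p \<and> q0 \<le> p \<longrightarrow>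
           (\<exists>L::nat. 0 < L \<and>
              (\<forall>G. is_MDS_gen p N K G \<longrightarrow>
                 (\<exists>PF PG qry ans.
                    is_PIR_scheme p N K T M L G PF PG qry ans \<and>
                    (\<forall>i\<in>{1..M}. PIR_rate p N K M L G PF PG qry ans i =
                       1 / (\<Sum>m<M. (1 - real ((N - T) choose K) / real (N choose K)) ^ m)))))"
proof -
  define a where "a = N choose K"
  define b where "b = a - ((N - T) choose K)"
  have pos: "0 < (N - T) choose K" using assms by simp
  have a: "0 < a" using assms by (simp add: a_def)
  have "(N - T) choose K < a"
  proof -
    let ?C = "\<lambda>A. {B. B \<subseteq> A \<and> card B = K}"
    \<comment> \<open>This block contains server \<open>N\<close>, which \<open>{1..N - T}\<close>
      lacks; it witnesses \<open>0 < b\<close>.\<close>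
    have "{N - K + 1..N} \<in> ?C {1..N} - ?C {1..N - T}" using assms by auto
    moreover have "?C {1..N - T} \<subseteq> ?C {1..N}" by fastforce
    ultimately have "?C {1..N - T} \<subset> ?C {1..N}" by blast
    moreover have "finite (?C {1..N})" by simp
    ultimately have "card (?C {1..N - T}) < card (?C {1..N})" by (rule psubset_card_mono[rotated])
    then show ?thesis by (simp add: n_subsets a_def)
  qed
  then have b: "0 < b" "b < a" and b_real: "real b = real a - real ((N - T) choose K)"
    using pos by (auto simp: b_def)
  have rate: "real b / real a = 1 - real ((N - T) choose K) / real (N choose K)"
    using a by (simp add: b_real a_def[symmetric] diff_divide_distrib)
  have "card {..<a} = card {B. B \<subseteq> {1..N} \<and> card B = K}" by (simp add: n_subsets a_def)
  then obtain blk where blk: "bij_betw blk {..<a} {B. B \<subseteq> {1..N} \<and> card B = K}"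
    using finite_same_card_bij[of "{..<a}" "{B. B \<subseteq> {1..N} \<and> card B = K}"] by auto
  show ?thesis
  \<comment> \<open>\<open>a * a < p\<close> keeps the points \<open>1..a * a\<close> distinct and
    nonzero modulo \<open>p\<close>. The number of rows has to be fixed before \<open>G\<close>, and
    \<open>a ^ M\<close> is.\<close>
  proof (rule exI[of _ "Suc (a * a)"], intro allI impI, rule exI[of _ "a ^ M"], intro conjI allI impI)
    fix p G assume p: "prime p \<and> Suc (a * a) \<le> p" and G: "is_MDS_gen p N K G"
    interpret MDS_storage p M a b N K T G blk
      using p G b blk assms by unfold_locales (auto simp: b_def)
    show "\<exists>PF PG qry ans. is_PIR_scheme p N K T M (a ^ M) G PF PG qry ans \<and>
        (\<forall>i\<in>{1..M}. PIR_rate p N K M (a ^ M) G PF PG qry ans i =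
           1 / (\<Sum>m<M. (1 - real ((N - T) choose K) / real (N choose K)) ^ m))"
      using PIR_scheme_exists unfolding rate .
  qed (use a in simp)
qed

end
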